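(* Let $\Omega\subset\mathbb{R}^N$ be a bounded $C^1$-domain, and let $\mathcal{I}(u,x)=\int_{\mathbb{R}^N}[u(x+z)-u(x)]\,\nu_x(dz)$ satisfy assumptions (M0), (M1), (M2) of the context with the same $\sigma\in(0,1)$. Let $m>\sigma$, $b_0>0$, $A_0\ge0$. If $u$ is a bounded viscosity subsolution to $$-\mathcal{I}(u,x)+b_0|Du|^m=A_0\quad\text{in }\Omega,$$ then there exists a constant $C_0>0$ such that $$|u(x)-u(y)|\le C_0|x-y|^{\frac{m-\sigma}{m}}\qquad\text{for all }x,y\in\Omega,$$ where $C_0$ depends on the data and on $\mathrm{osc}_{\bar\Omega}(u)$. In particular, $u:\Omega\to\mathbb{R}$ can be extended as a continuous function on $\bar\Omega$.
   Context: Notation: $d(x)=\mathrm{dist}(x,\partial\Omega)$, $B_r(x)$ is the open ball, $B_r=B_r(0)$, $B_r^c$ its complement. "$C^1$-domain" means that the boundary is $C^1$, with the convention that there is $\delta_0>0$ such that $d$ is of class $C^1$ in $\{x\in\Omega:d(x)<\delta_0\}$. $\mathrm{osc}_{\bar\Omega}(u)=\sup_{\bar\Omega}u-\inf_{\bar\Omega}u$. "The data" means $N,\Omega,\sigma,m,b_0,A_0$ and the constants $C_1,C_2$ below. For each $x\in\bar\Omega$, $\nu_x$ is a nonnegative regular measure on $\mathbb{R}^N$. For $D\subset\mathbb{R}^N$, $\mathcal{I}[D](u,y)=\int_D[u(y+z)-u(y)]\nu_y(dz)$. (M0): (M0-1) $\bigcup_{x\in\bar\Omega}\{x+\mathrm{supp}\,\nu_x\}\subseteq\bar\Omega$.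 (M0-2) if $x\in\bar\Omega$, $r>0$ and $u\in L^\infty(\bar\Omega)$ is $C^1$ in $B_r(x)$ (i.e. in $B_r(x)\cap\bar\Omega$), then $\mathcal{I}(u,x)$ is well defined, and for any $D\subset\mathbb{R}^N$ the map $y\mapsto\mathcal{I}[D](u,y)$ is continuous in $B_r(x)$ (i.e. in $B_r(x)\cap\bar\Omega$). (M1): there is $C_1>0$ such that for all $\beta\in[0,2]$ and $\delta>0$, $\sup_{x\in\bar\Omega}\int_{B_\delta^c}\min\{1,|z|^\beta\}\nu_x(dz)\le C_1h_{\beta,\sigma}(\delta)$, where $h_{\beta,\sigma}(\delta)=\delta^{\beta-\sigma}$ if $\beta<\sigma$, $=|\ln\delta|+1$ if $\beta=\sigma$, $=1$ if $\beta>\sigma$ (convention $|z|^0=1$). (M2): there is $C_2>0$ such that for all $\beta\in(\sigma,2]$ and $\delta\in(0,1)$, $\sup_{x\in\bar\Omega}\int_{B_\delta}|z|^\beta\nu_x(dz)\le C_2\delta^{\beta-\sigma}$. Viscosity subsolution in $\Omega$: an upper semicontinuous $u:\bar\Omega\to\mathbb{R}$ such that whenever $\phi\in C^1(\bar\Omega)$ and $u-\phi$ has a maximum on $\bar\Omega$ at $x_0\in\Omega$, then for all $\delta>0$, $-\mathcal{I}[B_\delta](\phi,x_0)-\mathcal{I}[B_\delta^c](u,x_0)+b_0|D\phi(x_0)|^m\le A_0$. *)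

theory Defs
  imports "HOL-Analysis.Analysis"
begin

section \<open>Functions of class C1 and C1-domains\<close>

text \<open>
  \<open>C1_on S f g\<close>: \<open>f\<close> is of class C1 on \<open>S\<close> with gradient \<open>g\<close>. The derivative is taken
  within \<open>S\<close>, so that the same notion serves open sets, the closure of a domain, and relatively
  open subsets of that closure. At interior points of \<open>S\<close> the vector \<open>g x\<close> is the usual gradient.
\<close>

definition C1_on :: "'a::euclidean_space set \<Rightarrow> ('a \<Rightarrow> real) \<Rightarrow> ('a \<Rightarrow> 'a) \<Rightarrow> bool" where
  "C1_on S f g \<longleftrightarrow>
     continuous_on S g \<and> (\<forall>x\<in>S. (f has_derivative (\<lambda>h. g x \<bullet> h)) (at x within S))"

definition bdry_dist :: "'a::euclidean_space set \<Rightarrow> 'a \<Rightarrow> real" where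
  "bdry_dist \<Omega> x = infdist x (frontier \<Omega>)"

text \<open>
  The boundary is locally the graph of a C1 function, with the set on one side of it. Instead of
  relabelling the coordinate axes we use a unit vector \<open>e\<close> as the vertical direction; \<open>\<gamma>\<close> is only
  evaluated on the hyperplane orthogonal to \<open>e\<close>.
\<close>

definition C1_boundary :: "'a::euclidean_space set \<Rightarrow> bool" where
  "C1_boundary \<Omega> \<longleftrightarrow>
     (\<forall>p\<in>frontier \<Omega>. \<exists>r>0. \<exists>e \<gamma> g. norm e = 1 \<and> C1_on UNIV \<gamma> g \<and>
        \<Omega> \<inter> ball p r = {x \<in> ball p r. \<gamma> (x - (x \<bullet> e) *\<^sub>R e) < x \<bullet> e})"

definition C1_domain :: "'a::euclidean_space set \<Rightarrow> bool" where
  "C1_domain \<Omega> \<longleftrightarrow>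
     open \<Omega> \<and> connected \<Omega> \<and> \<Omega> \<noteq> {} \<and> C1_boundary \<Omega> \<and>
     (\<exists>\<delta>0>0. \<exists>g. C1_on {x\<in>\<Omega>. bdry_dist \<Omega> x < \<delta>0} (bdry_dist \<Omega>) g)"

section \<open>The family of measures and the nonlocal operator\<close>

text \<open>
  The measures may have infinite mass near the origin (as Levy measures do), where classical outer
  regularity would fail for the set containing just the origin. Regularity is therefore required on
  the complement of the origin, the only part of the measure seen by the integrals below.
\<close>

definition regular_measure :: "'a::euclidean_space measure \<Rightarrow> bool" where
  "regular_measure \<mu> \<longleftrightarrow>
     sets \<mu> = sets borel \<and>
     (\<forall>A\<in>sets borel. 0 \<notin> A \<longrightarrow>
        emeasure \<mu> A = (SUP K\<in>{K. compact K \<and> K \<subseteq> A}. emeasure \<mu> K) \<and>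
        emeasure \<mu> A = (INF U\<in>{U. open U \<and> A \<subseteq> U}. emeasure \<mu> U))"

definition measure_support :: "'a::euclidean_space measure \<Rightarrow> 'a set" where
  "measure_support \<mu> = {z. \<forall>U. open U \<and> z \<in> U \<longrightarrow> emeasure \<mu> U > 0}"

text \<open>
  Functions on the closure of \<open>\<Omega>\<close> are modelled by total functions whose values outside the
  closure must not matter. Hence the integration over \<open>D\<close> is restricted to those \<open>z\<close> with \<open>y + z\<close>
  in the closure; by \<open>M0_1\<close> the other \<open>z\<close> form a null set of \<open>\<nu> y\<close>.
\<close>

definition nonlocal_integrable ::
  "'a::euclidean_space set \<Rightarrow> ('a \<Rightarrow> 'a measure) \<Rightarrow> 'a set \<Rightarrow> ('a \<Rightarrow> real) \<Rightarrow> 'a \<Rightarrow> bool" where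
  "nonlocal_integrable \<Omega> \<nu> D u y \<longleftrightarrow>
     set_integrable (\<nu> y) (D \<inter> {z. y + z \<in> closure \<Omega>}) (\<lambda>z. u (y + z) - u y)"

definition nonlocal ::
  "'a::euclidean_space set \<Rightarrow> ('a \<Rightarrow> 'a measure) \<Rightarrow> 'a set \<Rightarrow> ('a \<Rightarrow> real) \<Rightarrow> 'a \<Rightarrow> real" where
  "nonlocal \<Omega> \<nu> D u y =
     set_lebesgue_integral (\<nu> y) (D \<inter> {z. y + z \<in> closure \<Omega>}) (\<lambda>z. u (y + z) - u y)"

definition M0_1 :: "'a::euclidean_space set \<Rightarrow> ('a \<Rightarrow> 'a measure) \<Rightarrow> bool" where
  "M0_1 \<Omega> \<nu> \<longleftrightarrow> (\<Union>x\<in>closure \<Omega>. (\<lambda>z. x + z) ` measure_support (\<nu> x)) \<subseteq> closure \<Omega>"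

text \<open>
  As the measures \<open>\<nu> x\<close> may be singular, bounded functions are genuine bounded Borel functions on
  the closure of \<open>\<Omega>\<close>, not classes modulo Lebesgue null sets.
\<close>

definition M0_2 :: "'a::euclidean_space set \<Rightarrow> ('a \<Rightarrow> 'a measure) \<Rightarrow> bool" where
  "M0_2 \<Omega> \<nu> \<longleftrightarrow>
     (\<forall>x\<in>closure \<Omega>. \<forall>r>0. \<forall>u g.
        u \<in> borel_measurable (restrict_space borel (closure \<Omega>)) \<and> bounded (u ` closure \<Omega>) \<and>
        C1_on (ball x r \<inter> closure \<Omega>) u g \<longrightarrow>
          nonlocal_integrable \<Omega> \<nu> UNIV u x \<and>
          (\<forall>D\<in>sets borel. continuous_on (ball x r \<inter> closure \<Omega>) (nonlocal \<Omega> \<nu> D u)))"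

definition h_fun :: "real \<Rightarrow> real \<Rightarrow> real \<Rightarrow> real" where
  "h_fun \<beta> \<sigma> \<delta> =
     (if \<beta> < \<sigma> then \<delta> powr (\<beta> - \<sigma>) else if \<beta> = \<sigma> then \<bar>ln \<delta>\<bar> + 1 else 1)"

text \<open>
  \<open>norm z powr 0 = 1\<close> for all \<open>z\<close> in the domain of integration of \<open>M1\<close>, as \<open>z\<close> is nonzero there.
\<close>

definition M1 :: "'a::euclidean_space set \<Rightarrow> ('a \<Rightarrow> 'a measure) \<Rightarrow> real \<Rightarrow> real \<Rightarrow> bool" where
  "M1 \<Omega> \<nu> \<sigma> C1 \<longleftrightarrow>
     (\<forall>\<beta>\<in>{0..2}. \<forall>\<delta>>0.
        (SUP x\<in>closure \<Omega>. \<integral>\<^sup>+z\<in>- ball 0 \<delta>. ennreal (min 1 (norm z powr \<beta>)) \<partial>\<nu> x)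
          \<le> ennreal (C1 * h_fun \<beta> \<sigma> \<delta>))"

definition M2 :: "'a::euclidean_space set \<Rightarrow> ('a \<Rightarrow> 'a measure) \<Rightarrow> real \<Rightarrow> real \<Rightarrow> bool" where
  "M2 \<Omega> \<nu> \<sigma> C2 \<longleftrightarrow>
     (\<forall>\<beta>\<in>{\<sigma><..2}. \<forall>\<delta>\<in>{0<..<1}.
        (SUP x\<in>closure \<Omega>. \<integral>\<^sup>+z\<in>ball 0 \<delta>. ennreal (norm z powr \<beta>) \<partial>\<nu> x)
          \<le> ennreal (C2 * \<delta> powr (\<beta> - \<sigma>)))"

section \<open>Viscosity subsolutions and oscillation\<close>

definition usc_on :: "'a::topological_space set \<Rightarrow> ('a \<Rightarrow> real) \<Rightarrow> bool" where
  "usc_on S u \<longleftrightarrow> (\<forall>x\<in>S. \<forall>a>u x. eventually (\<lambda>y. u y < a) (at x within S))"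

definition viscosity_subsolution ::
  "'a::euclidean_space set \<Rightarrow> ('a \<Rightarrow> 'a measure) \<Rightarrow> real \<Rightarrow> real \<Rightarrow> real \<Rightarrow> ('a \<Rightarrow> real) \<Rightarrow> bool" where
  "viscosity_subsolution \<Omega> \<nu> b0 m A0 u \<longleftrightarrow>
     usc_on (closure \<Omega>) u \<and>
     (\<forall>\<phi> D\<phi>. \<forall>x0\<in>\<Omega>.
        C1_on (closure \<Omega>) \<phi> D\<phi> \<and> (\<forall>y\<in>closure \<Omega>. u y - \<phi> y \<le> u x0 - \<phi> x0) \<longrightarrow>
        (\<forall>\<delta>>0. - nonlocal \<Omega> \<nu> (ball 0 \<delta>) \<phi> x0 - nonlocal \<Omega> \<nu> (- ball 0 \<delta>) u x0
                 + b0 * norm (D\<phi> x0) powr m \<le> A0))"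

definition osc :: "'a set \<Rightarrow> ('a \<Rightarrow> real) \<Rightarrow> real" where
  "osc S u = (SUP x\<in>S. u x) - (INF x\<in>S. u x)"

end

theory Submission
  imports Defs
begin

text \<open>
  Put \<open>\<alpha> = (m - \<sigma>) / m\<close>, so that \<open>(\<alpha> - 1) m = - \<sigma>\<close>: a function with gradient of order
  \<open>L \<delta> powr (\<alpha> - 1)\<close> at distance \<open>\<delta>\<close> from its singularities gives a Hamiltonian term of order
  \<open>L powr m \<delta> powr (- \<sigma>)\<close>, which for large \<open>L\<close> beats the nonlocal terms, both of order
  \<open>osc u \<delta> powr (- \<sigma>)\<close>. In a ball of radius \<open>R\<close> around \<open>x0\<close> contained in \<open>\<Omega>\<close> we compare \<open>u\<close> with
  \<open>u x0 + L (r powr \<alpha> + R powr \<alpha> r\<^sup>2 / (R\<^sup>2 - r\<^sup>2))\<close>, where \<open>r\<close> is the distance to \<open>x0\<close>. The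
  second summand blows up on the sphere, which keeps the maximum point away from it, yet is at most
  a multiple of \<open>r powr \<alpha>\<close> for \<open>r \<le> R / 2\<close>; hence \<open>L\<close> does not depend on \<open>R\<close>. The resulting
  interior estimates are summed along the axes of uniform interior cones, on points approaching the
  boundary geometrically.
\<close>

section \<open>The comparison function\<close>

text \<open>As a function of the square of \<open>\<rho>\<close>,
  \<open>\<rho> powr \<alpha>\<close> is a power with exponent \<open>\<alpha> / 2 \<le> 1\<close>,
  hence concave and below its tangent at the square of \<open>r\<close>. After scaling to
  \<open>r = 1\<close> this is Young's inequality for \<open>t\<^sup>2\<close> and 1 with weights
  \<open>\<alpha> / 2\<close> and \<open>1 - \<alpha> / 2\<close>.\<close>

lemma powr_le_tangent_square:
  fixes r \<rho> \<alpha> :: real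
  assumes "0 < r" "0 \<le> \<rho>" "0 \<le> \<alpha>" "\<alpha> \<le> 2"
  shows "\<rho> powr \<alpha> \<le> r powr \<alpha> + \<alpha> / 2 * (r powr \<alpha> / r\<^sup>2) * (\<rho>\<^sup>2 - r\<^sup>2)"
proof -
  define t where "t = \<rho> / r"
  have t: "\<rho> = r * t" "0 \<le> t" using assms by (auto simp: t_def)
  have "t powr \<alpha> \<le> 1 + \<alpha>/2 * (t\<^sup>2 - 1)"
  proof (cases "t = 0")
    case False
    then have "t powr \<alpha> = (t\<^sup>2) powr (\<alpha>/2) * 1 powr (1 - \<alpha>/2)"
      using t(2) powr_powr[of t 2 "\<alpha>/2"] by simp
    also have "\<dots> \<le> \<alpha>/2 * t\<^sup>2 + (1 - \<alpha>/2) * 1"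
      using assms False by (intro Youngs_inequality_0) auto
    finally show ?thesis by (simp add: algebra_simps)
  qed (use assms in simp)
  then have "r powr \<alpha> * t powr \<alpha> \<le> r powr \<alpha> * (1 + \<alpha>/2 * (t\<^sup>2 - 1))"
    by (intro mult_left_mono) auto
  moreover have "\<rho> powr \<alpha> = r powr \<alpha> * t powr \<alpha>"
    using t assms by (simp add: powr_mult)
  moreover have "\<alpha> / 2 * (r powr \<alpha> / r\<^sup>2) * (\<rho>\<^sup>2 - r\<^sup>2) = \<alpha> / 2 * (r powr \<alpha> * (t\<^sup>2 - 1))"
    using assms by (simp add: t(1) field_simps power_mult_distrib)
  ultimately show ?thesis
    by (simp only:) (simp add: algebra_simps)
qed

text \<open>The affine part is the tangent to \<open>q / (S - q)\<close> at \<open>q = s\<close>.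
  The remainder is computed exactly, and \<open>h \<le> D / 2\<close> keeps its denominator away
  from zero.\<close>

lemma barrier_le_quadratic:
  fixes D S s h :: real
  assumes "0 < D" "s = S - D" "0 \<le> S" "h \<le> D / 2"
  shows "(s + h) / (S - (s + h)) \<le> s / D + S / D\<^sup>2 * h + 2 * S / D ^ 3 * h\<^sup>2"
proof -
  have pos: "0 < D - h" and S: "S = s + D" using assms by auto
  have "(s + h) / (D - h) - (s / D + S / D\<^sup>2 * h) = S * h\<^sup>2 / (D\<^sup>2 * (D - h))"
    unfolding S using assms(1) pos by (simp add: field_simps power2_eq_square)
  also have "\<dots> \<le> S * h\<^sup>2 / (D\<^sup>2 * (D / 2))"
    using assms pos by (intro divide_left_mono mult_left_mono mult_pos_pos) auto
  also have "\<dots> = 2 * S / D ^ 3 * h\<^sup>2"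
    by (simp add: field_simps power3_eq_cube power2_eq_square)
  finally show ?thesis using S by (simp add: algebra_simps)
qed

text \<open>
  With \<open>h = (norm (y - x0))\<^sup>2 - r\<^sup>2\<close>, the test function is \<open>A h + B h\<^sup>2\<close>: \<open>A\<close> is the derivative of
  the comparison function with respect to the squared distance, the first part of \<open>B\<close> dominates its
  second-order remainder for \<open>h \<le> D / 2\<close>, and \<open>4 w / D\<^sup>2\<close> makes the test function exceed the
  oscillation \<open>w\<close> for \<open>h \<ge> D / 2\<close>. Being a polynomial, it is C1 also at \<open>x0\<close> and across the sphere.
\<close>

lemma test_function_estimates:
  fixes r R L \<alpha> w :: real
  defines "D \<equiv> R\<^sup>2 - r\<^sup>2" and "\<delta> \<equiv> min r (R - r)"
  defines "A \<equiv> L * (\<alpha> / 2 * (r powr \<alpha> / r\<^sup>2) + R powr \<alpha> * (R\<^sup>2 / D\<^sup>2))"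
    and "B \<equiv> L * R powr \<alpha> * (2 * R\<^sup>2 / D ^ 3) + 4 * w / D\<^sup>2"
  assumes pos: "0 < r" "r < R" "0 < L" "0 < \<alpha>" "\<alpha> \<le> 1"
    and w: "L * (r powr \<alpha> + R powr \<alpha> * (r\<^sup>2 / D)) \<le> w"
  shows "A * r * \<delta> \<le> 2 * w" "B * r\<^sup>2 * \<delta>\<^sup>2 \<le> 6 * w"
    "min \<alpha> (1/4) * L * \<delta> powr (\<alpha> - 1) \<le> 2 * A * r"
proof -
  \<comment> \<open>\<open>L * X\<close> and \<open>L * b\<close> are the two parts of the
    comparison function at distance \<open>r\<close>; their sum is at most \<open>w\<close>.\<close>
  define X Y where "X = r powr \<alpha>" and "Y = R powr \<alpha>"
  define b where "b = Y * (r\<^sup>2 / D)"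
  have [simp]: "0 < X" "0 < Y" using pos by (auto simp: X_def Y_def)
  have \<delta>: "0 < \<delta>" "\<delta> \<le> r" "\<delta> \<le> R - r" using pos by (auto simp: \<delta>_def)
  have Dfac: "D = (R - r) * (R + r)" by (simp add: D_def power2_eq_square algebra_simps)
  have D: "R * (R - r) \<le> D" "D \<le> 2 * R * (R - r)"
    using mult_left_mono[of R "R + r" "R - r"] mult_left_mono[of "R + r" "2 * R" "R - r"] pos
    unfolding Dfac by (auto simp: mult_ac)
  have "0 < D" using D(1) pos by (smt (verit) mult_pos_pos)
  have \<delta>R: "\<delta> * R \<le> 2 * r * (R - r)"
  \<comment> \<open>The larger of \<open>r\<close> and \<open>R - r\<close> is at least
    \<open>R / 2\<close>, and its product with \<open>\<delta>\<close> is
    \<open>r * (R - r)\<close>.\<close>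
  proof (cases "r \<le> R - r")
    case True
    then have "r * R \<le> r * (2 * (R - r))" using pos by (intro mult_left_mono) auto
    then show ?thesis using True by (simp add: \<delta>_def algebra_simps)
  next
    case False
    then have "(R - r) * R \<le> (R - r) * (2 * r)" using pos by (intro mult_left_mono) auto
    then show ?thesis using False by (simp add: \<delta>_def mult_ac)
  qed
  have b0: "0 \<le> b" using \<open>0 < D\<close> by (simp add: b_def less_imp_le)
  have w': "L * X + L * b \<le> w" using w by (simp add: X_def b_def Y_def algebra_simps)
  have LX: "0 \<le> L * X" "0 \<le> L * b" using pos b0 by (simp_all add: less_imp_le)
  have R\<delta>: "R * \<delta> \<le> D" using D(1) \<delta>(3) pos by (smt (verit) mult_left_mono)
  show "A * r * \<delta> \<le> 2 * w"
  proof -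
    have "\<alpha> / 2 * (X / r\<^sup>2) * r * \<delta> = \<alpha> / 2 * X * (\<delta> / r)"
      using pos by (simp add: power2_eq_square)
    also have "\<dots> \<le> 1 / 2 * X * 1"
      using pos \<delta> by (intro mult_mono) (auto simp: less_imp_le)
    finally have 1: "\<alpha> / 2 * (X / r\<^sup>2) * r * \<delta> \<le> X / 2" by simp
    \<comment> \<open>The second part of \<open>A\<close> contributes \<open>b\<close> times
      \<open>R\<^sup>2 * \<delta> / (r * D)\<close>; this factor is at most 2 by
      \<open>\<delta>R\<close> and the lower bound on \<open>D\<close>.\<close>
    have "\<delta> * R * R \<le> 2 * r * (R - r) * R" using \<delta>R pos by (intro mult_right_mono) auto
    also have "\<dots> = 2 * r * (R * (R - r))" by simp
    also have "\<dots> \<le> 2 * r * D" using D pos by (intro mult_left_mono) auto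
    finally have "R\<^sup>2 * \<delta> / (r * D) \<le> 2"
      using \<open>0 < D\<close> pos by (simp add: field_simps power2_eq_square)
    then have "b * (R\<^sup>2 * \<delta> / (r * D)) \<le> b * 2" using b0 by (intro mult_left_mono)
    moreover have "Y * (R\<^sup>2 / D\<^sup>2) * r * \<delta> = b * (R\<^sup>2 * \<delta> / (r * D))"
      using pos \<open>0 < D\<close> by (simp add: b_def field_simps power2_eq_square)
    ultimately have "\<alpha> / 2 * (X / r\<^sup>2) * r * \<delta> + Y * (R\<^sup>2 / D\<^sup>2) * r * \<delta> \<le> X / 2 + 2 * b"
      using 1 by linarith
    then have "L * (\<alpha> / 2 * (X / r\<^sup>2) * r * \<delta> + Y * (R\<^sup>2 / D\<^sup>2) * r * \<delta>) \<le> L * (X / 2 + 2 * b)"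
      using pos by (intro mult_left_mono) auto
    then have "A * r * \<delta> \<le> L * X / 2 + 2 * (L * b)"
      by (simp add: A_def X_def Y_def algebra_simps)
    then show ?thesis using w' LX by linarith
  qed
  show "B * r\<^sup>2 * \<delta>\<^sup>2 \<le> 6 * w"
  proof -
    \<comment> \<open>Both parts of \<open>B\<close> become multiples of squared ratios not
      exceeding 1, which leaves \<open>2 * w + 4 * w\<close>.\<close>
    have "r * \<delta> \<le> D" using R\<delta> \<delta>(1) pos mult_right_mono[of r R \<delta>] by linarith
    then have "(R * \<delta> / D)\<^sup>2 \<le> 1" "(r * \<delta> / D)\<^sup>2 \<le> 1"
      using R\<delta> \<delta>(1) \<open>0 < D\<close> pos by (auto intro!: power_le_one)
    then have "2 * (L * b) * (R * \<delta> / D)\<^sup>2 + 4 * w * (r * \<delta> / D)\<^sup>2 \<le> 2 * (L * b) * 1 + 4 * w * 1"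
      using LX w' by (intro add_mono mult_left_mono) auto
    moreover have "B * r\<^sup>2 * \<delta>\<^sup>2 = 2 * (L * b) * (R * \<delta> / D)\<^sup>2 + 4 * w * (r * \<delta> / D)\<^sup>2"
      using \<open>0 < D\<close> by (simp add: B_def b_def Y_def field_simps power2_eq_square power3_eq_cube)
    ultimately show ?thesis using w' LX by linarith
  qed
  have \<delta>p: "\<delta> powr (\<alpha> - 1) = \<delta> powr \<alpha> / \<delta>" using \<delta> by (simp add: powr_diff)
  have Age: "L * (\<alpha> / 2 * (X / r\<^sup>2)) \<le> A" "L * (Y * (R\<^sup>2 / D\<^sup>2)) \<le> A"
    unfolding A_def X_def[symmetric] Y_def[symmetric] using pos
    by (intro mult_left_mono; simp add: less_imp_le)+
  show "min \<alpha> (1/4) * L * \<delta> powr (\<alpha> - 1) \<le> 2 * A * r"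
  \<comment> \<open>Nearer to the centre the power part of \<open>A\<close> suffices and gives the
    factor \<open>\<alpha>\<close>. Nearer to the sphere the barrier part does: there
    \<open>R < 2 * r\<close> and \<open>D \<le> 2 * R * \<delta>\<close> give the factor
    1/4.\<close>
  proof (cases "r \<le> R - r")
    case True
    then have "\<delta> = r" by (simp add: \<delta>_def)
    have "min \<alpha> (1/4) * L * \<delta> powr (\<alpha> - 1) \<le> \<alpha> * L * (X / r)"
      unfolding \<delta>p using \<open>\<delta> = r\<close> pos by (intro mult_mono) (auto simp: X_def)
    also have "\<dots> = 2 * (L * (\<alpha> / 2 * (X / r\<^sup>2))) * r"
      using pos by (simp add: power2_eq_square)
    also have "\<dots> \<le> 2 * A * r"
      using Age pos by (intro mult_right_mono mult_left_mono) auto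
    finally show ?thesis .
  next
    case False
    then have \<delta>e: "\<delta> = R - r" by (simp add: \<delta>_def)
    have "min \<alpha> (1/4) * L * \<delta> powr (\<alpha> - 1) \<le> 1/4 * L * (Y * R / \<delta>\<^sup>2)"
    proof (intro mult_mono)
      have "\<delta> powr \<alpha> * \<delta> \<le> Y * R"
        unfolding Y_def using \<delta> pos by (intro mult_mono powr_mono2) auto
      then show "\<delta> powr (\<alpha> - 1) \<le> Y * R / \<delta>\<^sup>2"
        unfolding \<delta>p using \<delta> by (simp add: field_simps power2_eq_square)
    qed (use pos in auto)
    also have "\<dots> \<le> 2 * (L * (Y * (R\<^sup>2 / D\<^sup>2))) * r"
    proof -
      have "D\<^sup>2 \<le> (2 * R * \<delta>)\<^sup>2" using D \<delta>e \<open>0 < D\<close> by (intro power_mono) auto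
      then have "R * D\<^sup>2 \<le> R * (2 * R * \<delta>)\<^sup>2" using pos by (intro mult_left_mono) auto
      also have "\<dots> \<le> (2 * r) * (2 * R * \<delta>)\<^sup>2"
        using False by (intro mult_right_mono) auto
      finally have "1/4 * (R / \<delta>\<^sup>2) \<le> 2 * (R\<^sup>2 / D\<^sup>2) * r"
        using \<delta> \<open>0 < D\<close> by (simp add: field_simps power2_eq_square)
      then have "L * Y * (1/4 * (R / \<delta>\<^sup>2)) \<le> L * Y * (2 * (R\<^sup>2 / D\<^sup>2) * r)"
        using pos by (intro mult_left_mono) (auto simp: less_imp_le)
      then show ?thesis by (simp add: algebra_simps)
    qed
    also have "\<dots> \<le> 2 * A * r"
      using Age pos by (intro mult_right_mono mult_left_mono) auto
    finally show ?thesis .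
  qed
qed

section \<open>Semicontinuity and the nonlocal operator\<close>

text \<open>Otherwise every \<open>x\<close> has a better point \<open>w x\<close>, and
  \<open>f < f (w x)\<close> near \<open>x\<close> by semicontinuity. Among the finitely many
  centres of a subcover, the best \<open>w c\<close> is itself covered, hence beaten by some
  \<open>w d\<close>.\<close>

lemma usc_attains_max:
  fixes f :: "'a::topological_space \<Rightarrow> real"
  assumes "compact S" "S \<noteq> {}" "usc_on S f"
  shows "\<exists>x\<in>S. \<forall>y\<in>S. f y \<le> f x"
proof (rule ccontr)
  assume "\<not> ?thesis"
  then obtain w where w: "\<And>x. x \<in> S \<Longrightarrow> w x \<in> S \<and> f x < f (w x)"
    by (metis linorder_not_le)
  have "\<exists>T. open T \<and> x \<in> T \<and> (\<forall>y\<in>T \<inter> S. f y < f (w x))" if "x \<in> S" for x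
    using assms(3) that w[OF that] unfolding usc_on_def eventually_at_topological by (metis IntE)
  then obtain T where T: "\<And>x. x \<in> S \<Longrightarrow> open (T x) \<and> x \<in> T x \<and> (\<forall>y\<in>T x \<inter> S. f y < f (w x))"
    by metis
  obtain F where F: "F \<subseteq> S" "finite F" "S \<subseteq> (\<Union>c\<in>F. T c)"
    using compactE_image[OF assms(1), of S T] T by blast
  with assms(2) have "F \<noteq> {}" by auto
  then have "Max ((\<lambda>c. f (w c)) ` F) \<in> (\<lambda>c. f (w c)) ` F"
    using F by (intro Max_in) auto
  then obtain c where c: "c \<in> F" "f (w c) = Max ((\<lambda>c. f (w c)) ` F)" by auto
  have "w c \<in> S" using c F w by auto
  then obtain d where d: "d \<in> F" "w c \<in> T d" using F by auto
  then have "f (w c) < f (w d)" using T F \<open>w c \<in> S\<close> by blast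
  moreover have "f (w d) \<le> f (w c)" unfolding c(2) using F d by (intro Max_ge) auto
  ultimately show False by simp
qed

lemma usc_on_diff_continuous:
  fixes f g :: "'a::topological_space \<Rightarrow> real"
  assumes "usc_on T f" "S \<subseteq> T" "continuous_on S g"
  shows "usc_on S (\<lambda>x. f x - g x)"
  unfolding usc_on_def
proof (intro ballI allI impI)
  fix x a assume x: "x \<in> S" "f x - g x < a"
  define e where "e = (a - (f x - g x)) / 2"
  have e: "0 < e" using x by (simp add: e_def)
  have "eventually (\<lambda>y. f y < f x + e) (at x within T)"
    using assms(1,2) x e unfolding usc_on_def by (meson in_mono less_add_same_cancel1)
  then have 1: "eventually (\<lambda>y. f y < f x + e) (at x within S)"
    using at_le[OF assms(2), of x] by (simp add: le_filter_def)
  have "(g \<longlongrightarrow> g x) (at x within S)" using assms(3) x by (simp add: continuous_on)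
  then have 2: "eventually (\<lambda>y. g x - e < g y) (at x within S)"
    using e by (intro order_tendstoD) auto
  from 1 2 show "eventually (\<lambda>y. f y - g y < a) (at x within S)"
    by eventually_elim (use e in \<open>simp add: e_def field_simps\<close>)
qed

lemma osc_ge:
  assumes "bounded (u ` S)" "x \<in> S" "y \<in> S"
  shows "\<bar>u x - u y\<bar> \<le> osc S u"
proof -
  have "bdd_above (u ` S)" "bdd_below (u ` S)"
    using assms(1) by (auto simp: bounded_imp_bdd_above bounded_imp_bdd_below)
  then have "u z \<le> (SUP x\<in>S. u x)" "(INF x\<in>S. u x) \<le> u z" if "z \<in> S" for z
    using that by (auto intro: cSUP_upper cINF_lower)
  from this[OF assms(2)] this[OF assms(3)] show ?thesis unfolding osc_def by linarith
qed

lemma integral_abs_le_nn_integral: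
  fixes f g :: "'a \<Rightarrow> real"
  assumes "\<And>z. z \<in> space M \<Longrightarrow> \<bar>f z\<bar> \<le> g z" and "(\<integral>\<^sup>+z. ennreal (g z) \<partial>M) \<le> ennreal c" and "0 \<le> c"
  shows "\<bar>integral\<^sup>L M f\<bar> \<le> c"
proof (cases "integrable M f")
  case True
  have "ennreal \<bar>integral\<^sup>L M f\<bar> \<le> (\<integral>\<^sup>+z. ennreal \<bar>f z\<bar> \<partial>M)"
    using integral_norm_bound_ennreal[OF True] by simp
  also have "\<dots> \<le> (\<integral>\<^sup>+z. ennreal (g z) \<partial>M)"
    using assms(1) by (intro nn_integral_mono ennreal_leI) auto
  also note assms(2)
  finally show ?thesis using assms(3) by simp
\<comment> \<open>A non-integrable \<open>f\<close> has integral 0 by convention, so the bound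
  reduces to \<open>0 \<le> c\<close>.\<close>
qed (simp add: not_integrable_integral_eq assms(3))

text \<open>\<open>M1\<close> with exponent 0 bounds the mass of \<open>\<nu> x\<close> outside the
  ball by \<open>C1 * \<delta> powr (- \<sigma>)\<close>, and the integrand is at most
  \<open>w\<close> in modulus.\<close>

lemma nonlocal_outside_ball_le:
  fixes u :: "'a::euclidean_space \<Rightarrow> real"
  assumes "sets (\<nu> x) = sets borel" "M1 \<Omega> \<nu> \<sigma> C1" "x \<in> closure \<Omega>" "0 < \<sigma>" "0 < \<delta>" "0 \<le> C1"
    and w: "\<And>y. y \<in> closure \<Omega> \<Longrightarrow> \<bar>u y - u x\<bar> \<le> w"
  shows "\<bar>nonlocal \<Omega> \<nu> (- ball 0 \<delta>) u x\<bar> \<le> C1 * w * \<delta> powr (- \<sigma>)"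
proof -
  note [measurable_cong] = assms(1)
  have w0: "0 \<le> w" using w[OF assms(3)] by simp
  have "(SUP x\<in>closure \<Omega>. \<integral>\<^sup>+z\<in>- ball 0 \<delta>. ennreal (min 1 (norm z powr 0)) \<partial>\<nu> x)
      \<le> ennreal (C1 * h_fun 0 \<sigma> \<delta>)"
    using assms(2,5) unfolding M1_def by fastforce
  then have "(\<integral>\<^sup>+z\<in>- ball 0 \<delta>. ennreal (min 1 (norm z powr 0)) \<partial>\<nu> x) \<le> ennreal (C1 * \<delta> powr (- \<sigma>))"
    using assms(3,4) unfolding h_fun_def by (auto simp: SUP_le_iff)
  then have "ennreal w * (\<integral>\<^sup>+z. ennreal (min 1 (norm z powr 0)) * indicator (- ball 0 \<delta>) z \<partial>\<nu> x)
      \<le> ennreal w * ennreal (C1 * \<delta> powr (- \<sigma>))"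
    by (intro mult_left_mono) auto
  also have "\<dots> = ennreal (C1 * w * \<delta> powr (- \<sigma>))"
    using w0 assms by (simp add: ennreal_mult' [symmetric] mult_ac)
  \<comment> \<open>As \<open>\<delta> > 0\<close>, the origin is excluded, where
    \<open>0 powr 0 = 0\<close>; elsewhere the minimum is 1.\<close>
  also have "ennreal w * (\<integral>\<^sup>+z. ennreal (min 1 (norm z powr 0)) * indicator (- ball 0 \<delta>) z \<partial>\<nu> x)
      = (\<integral>\<^sup>+z. ennreal (w * indicator (- ball 0 \<delta>) z) \<partial>\<nu> x)"
    using assms(5) w0
    by (subst nn_integral_cmult [symmetric])
      (auto intro!: nn_integral_cong simp: indicator_def)
  finally show ?thesis
    unfolding nonlocal_def set_lebesgue_integral_def
    using w w0 assms(6)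
    by (intro integral_abs_le_nn_integral[where g = "\<lambda>z. w * indicator (- ball 0 \<delta>) z"])
      (auto simp: indicator_def)
qed

text \<open>\<open>M2\<close> is used with exponent 1, admissible because
  \<open>\<sigma> < 1\<close>. Writing the slope as \<open>k / \<delta>\<close> gives the result the
  same scale in \<open>\<delta>\<close> as the bound outside the ball.\<close>

lemma nonlocal_ball_le:
  fixes \<phi> :: "'a::euclidean_space \<Rightarrow> real"
  assumes "sets (\<nu> x) = sets borel" "M2 \<Omega> \<nu> \<sigma> C2" "x \<in> closure \<Omega>" "\<sigma> < 1" "0 < \<delta>" "\<delta> < 1"
    "0 \<le> C2" "0 \<le> k"
    and k: "\<And>z. norm z < \<delta> \<Longrightarrow> \<bar>\<phi> (x + z) - \<phi> x\<bar> \<le> k / \<delta> * norm z"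
  shows "\<bar>nonlocal \<Omega> \<nu> (ball 0 \<delta>) \<phi> x\<bar> \<le> C2 * k * \<delta> powr (- \<sigma>)"
proof -
  note [measurable_cong] = assms(1)
  have "(SUP x\<in>closure \<Omega>. \<integral>\<^sup>+z\<in>ball 0 \<delta>. ennreal (norm z powr 1) \<partial>\<nu> x)
      \<le> ennreal (C2 * \<delta> powr (1 - \<sigma>))"
    using assms(2,4-6) unfolding M2_def by fastforce
  then have "(\<integral>\<^sup>+z\<in>ball 0 \<delta>. ennreal (norm z powr 1) \<partial>\<nu> x) \<le> ennreal (C2 * \<delta> powr (1 - \<sigma>))"
    using assms(3) by (auto simp: SUP_le_iff)
  then have "ennreal (k / \<delta>) * (\<integral>\<^sup>+z. ennreal (norm z powr 1) * indicator (ball 0 \<delta>) z \<partial>\<nu> x)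
      \<le> ennreal (k / \<delta>) * ennreal (C2 * \<delta> powr (1 - \<sigma>))"
    by (intro mult_left_mono) auto
  also have "\<dots> = ennreal (C2 * k * (\<delta> powr (1 - \<sigma>) / \<delta>))"
    using assms by (simp add: ennreal_mult' [symmetric] mult_ac)
  also have "\<delta> powr (1 - \<sigma>) / \<delta> = \<delta> powr (- \<sigma>)"
    using assms(5) by (simp add: powr_diff powr_minus field_simps)
  also have "ennreal (k / \<delta>) * (\<integral>\<^sup>+z. ennreal (norm z powr 1) * indicator (ball 0 \<delta>) z \<partial>\<nu> x)
      = (\<integral>\<^sup>+z. ennreal (k / \<delta> * norm z * indicator (ball 0 \<delta>) z) \<partial>\<nu> x)"
    using assms(5,8)
    by (subst nn_integral_cmult [symmetric])
      (auto intro!: nn_integral_cong simp: indicator_def ennreal_mult'[symmetric])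
  finally show ?thesis
    unfolding nonlocal_def set_lebesgue_integral_def
    using k assms(5,7,8)
    by (intro integral_abs_le_nn_integral[where g = "\<lambda>z. k / \<delta> * norm z * indicator (ball 0 \<delta>) z"])
      (auto simp: indicator_def)
qed

lemma C1_on_quadratic_norm:
  fixes x0 :: "'a::euclidean_space"
  shows "C1_on S (\<lambda>y. A * ((norm (y - x0))\<^sup>2 - s) + B * ((norm (y - x0))\<^sup>2 - s)\<^sup>2)
    (\<lambda>y. (2 * A + 4 * B * ((norm (y - x0))\<^sup>2 - s)) *\<^sub>R (y - x0))"
  unfolding C1_on_def power2_norm_eq_inner
  by (intro conjI ballI continuous_intros)
    (auto intro!: derivative_eq_intros simp: fun_eq_iff algebra_simps inner_commute)

section \<open>The interior estimate\<close>

text \<open>The number \<open>L\<close> for which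
  \<open>b0 * (min \<alpha> (1/4) * L) powr m\<close> equals
  \<open>A0 + (60 * C2 + C1) * w + b0\<close>, with \<open>\<alpha> = (m - \<sigma>) / m\<close>:
  the sum of all terms the Hamiltonian must beat, plus a surplus \<open>b0\<close>.\<close>

definition interior_const ::
  "real \<Rightarrow> real \<Rightarrow> real \<Rightarrow> real \<Rightarrow> real \<Rightarrow> real \<Rightarrow> real \<Rightarrow> real" where
  "interior_const \<sigma> m b0 A0 C1 C2 w =
     ((A0 + (60 * C2 + C1) * w) / b0 + 1) powr (1 / m) / min ((m - \<sigma>) / m) (1/4)"

lemma interior_const_pos:
  assumes "0 < \<sigma>" "\<sigma> < m" "0 < b0" "0 \<le> A0" "0 < C1" "0 < C2" "0 \<le> w"
  shows "0 < interior_const \<sigma> m b0 A0 C1 C2 w"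
proof -
  have "0 \<le> (A0 + (60 * C2 + C1) * w) / b0" using assms by simp
  then have "0 < (A0 + (60 * C2 + C1) * w) / b0 + 1" by linarith
  then show ?thesis using assms unfolding interior_const_def
    by (intro divide_pos_pos) (auto simp: powr_gt_zero)
qed

text \<open>If the bound failed, \<open>u - \<phi>\<close> would have a maximum over the ball at
  some \<open>x1\<close> other than \<open>x0\<close>. There the polynomial \<open>P\<close> touches
  \<open>u\<close> from above, up to a constant, on the whole closure, and the subsolution
  inequality contradicts the choice of \<open>L\<close>, since both nonlocal terms are controlled by
  \<open>w\<close> and not by \<open>L\<close>.\<close>

lemma interior_barrier_bound:
  fixes \<Omega> :: "'a::euclidean_space set" and u :: "'a \<Rightarrow> real" and \<sigma> m b0 A0 C1 C2 R :: real
  defines "\<alpha> \<equiv> (m - \<sigma>) / m" and "w \<equiv> osc (closure \<Omega>) u"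
  defines "L \<equiv> interior_const \<sigma> m b0 A0 C1 C2 w"
  assumes par: "0 < \<sigma>" "\<sigma> < 1" "\<sigma> < m" "0 < b0" "0 \<le> A0" "0 < C1" "0 < C2"
    and sets: "\<And>x. x \<in> closure \<Omega> \<Longrightarrow> sets (\<nu> x) = sets borel"
    and M1: "M1 \<Omega> \<nu> \<sigma> C1" and M2: "M2 \<Omega> \<nu> \<sigma> C2"
    and bdd: "bounded (u ` closure \<Omega>)"
    and visc: "viscosity_subsolution \<Omega> \<nu> b0 m A0 u"
    and R: "0 < R" "R \<le> 1" "ball x0 R \<subseteq> \<Omega>" and "y1 \<in> ball x0 R"
  shows "u y1 - u x0 \<le> L * (norm (y1 - x0) powr \<alpha>
    + R powr \<alpha> * ((norm (y1 - x0))\<^sup>2 / (R\<^sup>2 - (norm (y1 - x0))\<^sup>2)))"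
proof (rule ccontr)
  define \<phi> where "\<phi> y = L * (norm (y - x0) powr \<alpha>
    + R powr \<alpha> * ((norm (y - x0))\<^sup>2 / (R\<^sup>2 - (norm (y - x0))\<^sup>2)))" for y
  assume "\<not> ?thesis"
  then have y1: "u x0 < u y1 - \<phi> y1" by (simp add: \<phi>_def)
  have \<Omega>cl: "x \<in> closure \<Omega>" if "x \<in> \<Omega>" for x using that closure_subset by blast
  have x0: "x0 \<in> closure \<Omega>" using R \<Omega>cl centre_in_ball by blast
  have osc: "\<bar>u x - u y\<bar> \<le> w" if "x \<in> closure \<Omega>" "y \<in> closure \<Omega>" for x y
    using osc_ge[OF bdd that] by (simp add: w_def)
  have w0: "0 \<le> w" using osc[OF x0 x0] by simp
  have \<alpha>: "0 < \<alpha>" "\<alpha> < 1" "(\<alpha> - 1) * m = - \<sigma>" using par by (auto simp: \<alpha>_def field_simps)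
  have L: "0 < L" unfolding L_def using par w0 by (intro interior_const_pos) auto

  \<comment> \<open>Existence of a maximum point inside the ball\<close>
  obtain x1 where x1: "x1 \<in> ball x0 R" and
    max: "\<And>y. y \<in> ball x0 R \<Longrightarrow> u y - \<phi> y \<le> u x1 - \<phi> x1"
  proof -
    \<comment> \<open>Where \<open>R\<^sup>2 - t\<^sup>2 < D'\<close>, the barrier forces
      \<open>\<phi> \<ge> w + 1\<close>. The summand \<open>L * R powr \<alpha>\<close> in the
      denominator pays for the 1 in \<open>R\<^sup>2 / (R\<^sup>2 - t\<^sup>2) = t\<^sup>2 /
      (R\<^sup>2 - t\<^sup>2) + 1\<close>; the minimum with \<open>R\<^sup>2\<close> keeps the
      radicand of \<open>R'\<close> nonnegative.\<close>
    define D' where "D' = min (R\<^sup>2) (L * R powr \<alpha> * R\<^sup>2 / (w + 1 + L * R powr \<alpha>))"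
    define R' where "R' = sqrt (R\<^sup>2 - D')"
    have D': "0 < D'" "D' \<le> R\<^sup>2" using R L w0
      by (auto simp: D'_def intro!: divide_pos_pos mult_pos_pos add_nonneg_pos)
    have R': "0 \<le> R'" "R'\<^sup>2 = R\<^sup>2 - D'" using D' by (auto simp: R'_def)
    have "R' < R" using R' D' R by (smt (verit) power_mono)
    have far: "u y - \<phi> y < u x0" if "y \<in> ball x0 R" "y \<notin> cball x0 R'" for y
    proof -
      define t where "t = norm (y - x0)"
      have t: "R' < t" "t < R" using that by (auto simp: t_def dist_norm norm_minus_commute)
      have t2: "R\<^sup>2 - t\<^sup>2 < D'" "0 < R\<^sup>2 - t\<^sup>2"
        using t R' power_strict_mono[of R' t 2] power_strict_mono[of t R 2] by auto
      have Q: "0 < L * R powr \<alpha>" using L R by simp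
      have "R\<^sup>2 / D' \<le> R\<^sup>2 / (R\<^sup>2 - t\<^sup>2)" using t2 by (intro divide_left_mono) auto
      moreover have "(w + 1 + L * R powr \<alpha>) / (L * R powr \<alpha>) \<le> R\<^sup>2 / D'"
      proof -
        have "D' \<le> L * R powr \<alpha> * R\<^sup>2 / (w + 1 + L * R powr \<alpha>)" by (simp add: D'_def)
        moreover have "0 < w + 1 + L * R powr \<alpha>" using w0 L R by (intro add_nonneg_pos mult_pos_pos) auto
        ultimately show ?thesis using D' L R by (simp add: field_simps)
      qed
      ultimately have "L * R powr \<alpha> * ((w + 1 + L * R powr \<alpha>) / (L * R powr \<alpha>))
          \<le> L * R powr \<alpha> * (R\<^sup>2 / (R\<^sup>2 - t\<^sup>2))"
        using L by (intro mult_left_mono) auto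
      also have "L * R powr \<alpha> * ((w + 1 + L * R powr \<alpha>) / (L * R powr \<alpha>)) = w + 1 + L * R powr \<alpha>"
        using Q by (metis less_irrefl nonzero_mult_div_cancel_left times_divide_eq_right)
      also have "R\<^sup>2 / (R\<^sup>2 - t\<^sup>2) = t\<^sup>2 / (R\<^sup>2 - t\<^sup>2) + 1" using t2 by (simp add: field_simps)
      finally have "w + 1 \<le> L * R powr \<alpha> * (t\<^sup>2 / (R\<^sup>2 - t\<^sup>2))"
        by (simp add: distrib_left)
      also have "\<dots> \<le> \<phi> y"
        using L by (simp add: \<phi>_def t_def[symmetric] algebra_simps)
      finally show ?thesis using osc[of y x0] x0 that(1) R \<Omega>cl by (smt (verit) subsetD)
    qed
    have \<phi>0: "\<phi> x0 = 0" by (simp add: \<phi>_def)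
    have x0': "x0 \<in> cball x0 R'" using R' by simp
    have sub: "cball x0 R' \<subseteq> ball x0 R" using \<open>R' < R\<close> by auto
    have "R\<^sup>2 - (norm (y - x0))\<^sup>2 \<noteq> 0" if "y \<in> cball x0 R'" for y
      using that \<open>R' < R\<close> power_strict_mono[of "norm (y - x0)" R 2]
      by (auto simp: dist_norm norm_minus_commute)
    then have "continuous_on (cball x0 R') (\<lambda>y. (norm (y - x0))\<^sup>2 / (R\<^sup>2 - (norm (y - x0))\<^sup>2))"
      by (intro continuous_intros) auto
    moreover have "continuous_on (cball x0 R') (\<lambda>y. norm (y - x0) powr \<alpha>)"
      using \<alpha> by (intro continuous_on_powr' continuous_intros) auto
    ultimately have "continuous_on (cball x0 R') \<phi>"
      unfolding \<phi>_def by (intro continuous_on_mult continuous_on_add continuous_on_const)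
    moreover have "usc_on (closure \<Omega>) u" using visc by (simp add: viscosity_subsolution_def)
    moreover have "cball x0 R' \<subseteq> closure \<Omega>" using sub R(3) closure_subset[of \<Omega>] by (meson order_trans)
    ultimately have "usc_on (cball x0 R') (\<lambda>y. u y - \<phi> y)"
      by (intro usc_on_diff_continuous[of "closure \<Omega>"])
    then obtain x1 where x1: "x1 \<in> cball x0 R'" "\<And>y. y \<in> cball x0 R' \<Longrightarrow> u y - \<phi> y \<le> u x1 - \<phi> x1"
      using usc_attains_max[OF compact_cball, of x0 R' "\<lambda>y. u y - \<phi> y"] x0' by auto
    show thesis
    proof (rule that[of x1])
      show "x1 \<in> ball x0 R" using sub x1 by blast
      \<comment> \<open>Outside the closed ball the value is below that at \<open>x0\<close>, which
        the maximum over the closed ball dominates.\<close>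
      show "u y - \<phi> y \<le> u x1 - \<phi> x1" if "y \<in> ball x0 R" for y
        using x1(2)[of y] x1(2)[OF x0'] far[OF that] \<phi>0 by fastforce
    qed
  qed

  \<comment> \<open>The polynomial test function at the maximum point\<close>
  define r where "r = norm (x1 - x0)"
  define D where "D = R\<^sup>2 - r\<^sup>2"
  \<comment> \<open>The distance from \<open>x1\<close> to the singularities of
    \<open>\<phi>\<close>, namely \<open>x0\<close> and the sphere; it also serves as the radius at
    which the nonlocal term is split.\<close>
  define \<delta> where "\<delta> = min r (R - r)"
  define A where "A = L * (\<alpha> / 2 * (r powr \<alpha> / r\<^sup>2) + R powr \<alpha> * (R\<^sup>2 / D\<^sup>2))"
  define B where "B = L * R powr \<alpha> * (2 * R\<^sup>2 / D ^ 3) + 4 * w / D\<^sup>2"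
  define P where "P y = A * ((norm (y - x0))\<^sup>2 - r\<^sup>2) + B * ((norm (y - x0))\<^sup>2 - r\<^sup>2)\<^sup>2" for y
  define DP where "DP y = (2 * A + 4 * B * ((norm (y - x0))\<^sup>2 - r\<^sup>2)) *\<^sub>R (y - x0)" for y

  have x1\<Omega>: "x1 \<in> \<Omega>" "x1 \<in> closure \<Omega>" using x1 R(3) \<Omega>cl by auto
  have gap: "\<phi> x1 < u x1 - u x0" using max[OF \<open>y1 \<in> ball x0 R\<close>] y1 by linarith
  have r: "0 < r" "r < R"
  proof -
    \<comment> \<open>\<open>\<phi>\<close> vanishes at \<open>x0\<close>, as
      \<open>0 powr \<alpha> = 0\<close>, so the strict inequality \<open>gap\<close> excludes
      \<open>x1 = x0\<close>.\<close>
    have "x1 \<noteq> x0" using gap by (auto simp: \<phi>_def)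
    then show "0 < r" by (simp add: r_def)
    show "r < R" using x1 by (simp add: r_def dist_norm norm_minus_commute)
  qed
  have D: "0 < D" using r power_strict_mono[of r R 2] by (simp add: D_def)
  have \<delta>: "0 < \<delta>" "\<delta> < 1" "\<delta> \<le> r" using r R by (auto simp: \<delta>_def)
  have \<phi>x1: "\<phi> x1 = L * (r powr \<alpha> + R powr \<alpha> * (r\<^sup>2 / D))" by (simp add: \<phi>_def r_def D_def)
  \<comment> \<open>The comparison function at \<open>x1\<close> stays below the oscillation.
    Through this the first two parts of \<open>est\<close> bound \<open>A\<close> and
    \<open>B\<close> by multiples of \<open>w\<close>, however large \<open>L\<close> is.\<close>
  then have "L * (r powr \<alpha> + R powr \<alpha> * (r\<^sup>2 / D)) \<le> w" using gap osc[OF x1\<Omega>(2) x0] by linarith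
  note est = test_function_estimates[OF r L \<alpha>(1) less_imp_le[OF \<alpha>(2)] this[unfolded D_def],
      folded D_def, folded A_def B_def \<delta>_def]
  have A0: "0 \<le> A" and B0: "0 \<le> B" using L \<alpha> D w0 by (auto simp: A_def B_def)
  have Px1: "P x1 = 0" by (simp add: P_def r_def)

  \<comment> \<open>For \<open>h \<le> D / 2\<close> the point lies in the ball and
    \<open>P y\<close> dominates \<open>\<phi> y - \<phi> x1\<close>. For larger \<open>h\<close>,
    possibly beyond the sphere where \<open>\<phi>\<close> is of no use, \<open>P y\<close> is at
    least \<open>w\<close>.\<close>
  have touch: "u y - P y \<le> u x1 - P x1" if y: "y \<in> closure \<Omega>" for y
  proof -
    define h where "h = (norm (y - x0))\<^sup>2 - r\<^sup>2"
    have Py: "P y = A * h + B * h\<^sup>2" by (simp add: P_def h_def)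
    show ?thesis
    proof (cases "h \<le> D / 2")
      case True
      then have "(norm (y - x0))\<^sup>2 < R\<^sup>2" using D by (simp add: h_def D_def field_simps)
      then have yb: "y \<in> ball x0 R" using R by (simp add: dist_norm norm_minus_commute power2_less_imp_less)
      have "norm (y - x0) powr \<alpha> \<le> r powr \<alpha> + \<alpha> / 2 * (r powr \<alpha> / r\<^sup>2) * h"
        unfolding h_def using r \<alpha> by (intro powr_le_tangent_square) auto
      moreover have "(norm (y - x0))\<^sup>2 / (R\<^sup>2 - (norm (y - x0))\<^sup>2)
          \<le> r\<^sup>2 / D + R\<^sup>2 / D\<^sup>2 * h + 2 * R\<^sup>2 / D ^ 3 * h\<^sup>2"
        using barrier_le_quadratic[OF D, of "r\<^sup>2" "R\<^sup>2" h] True by (simp add: D_def h_def)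
      ultimately have "\<phi> y \<le> L * ((r powr \<alpha> + \<alpha> / 2 * (r powr \<alpha> / r\<^sup>2) * h) +
          R powr \<alpha> * (r\<^sup>2 / D + R\<^sup>2 / D\<^sup>2 * h + 2 * R\<^sup>2 / D ^ 3 * h\<^sup>2))"
        unfolding \<phi>_def using L by (intro mult_left_mono add_mono) auto
      also have "\<dots> = \<phi> x1 + A * h + (B - 4 * w / D\<^sup>2) * h\<^sup>2"
        unfolding \<phi>x1 A_def B_def by (simp add: algebra_simps)
      also have "\<dots> \<le> \<phi> x1 + A * h + B * h\<^sup>2"
        using w0 by (intro add_left_mono mult_right_mono) auto
      finally show ?thesis using max[OF yb] Px1 Py by linarith
    next
      case False
      then have "(D / 2)\<^sup>2 \<le> h\<^sup>2" using D by (intro power_mono) auto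
      then have "4 * w / D\<^sup>2 * (D / 2)\<^sup>2 \<le> 4 * w / D\<^sup>2 * h\<^sup>2" using w0 by (intro mult_left_mono) auto
      also have "\<dots> \<le> B * h\<^sup>2" using L D by (intro mult_right_mono) (auto simp: B_def)
      also have "4 * w / D\<^sup>2 * (D / 2)\<^sup>2 = w" using D by (simp add: power_divide)
      finally have "w \<le> B * h\<^sup>2" .
      moreover have "0 \<le> A * h" using A0 False D by (intro mult_nonneg_nonneg) auto
      ultimately have "w \<le> P y" using Py by linarith
      then show ?thesis using osc[OF y x1\<Omega>(2)] Px1 by linarith
    qed
  qed

  \<comment> \<open>\<open>h\<close> factors as a difference of squares: one factor is at most
    \<open>norm z\<close>, the other at most \<open>3 * r\<close> because
    \<open>norm z < \<delta> \<le> r\<close>. The bounds on \<open>A\<close> and \<open>B\<close>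
    then give 6 and 54, whence the 60 in \<open>interior_const\<close>.\<close>
  have Pz: "\<bar>P (x1 + z) - P x1\<bar> \<le> 60 * w / \<delta> * norm z" if z: "norm z < \<delta>" for z
  proof -
    define h where "h = (norm (x1 + z - x0))\<^sup>2 - r\<^sup>2"
    have "\<bar>norm (x1 + z - x0) - r\<bar> \<le> norm z"
      using norm_triangle_ineq3[of "x1 + z - x0" "x1 - x0"] by (simp add: r_def)
    moreover have "\<bar>norm (x1 + z - x0) + r\<bar> \<le> 3 * r"
      using norm_triangle_ineq[of "x1 - x0" z] z \<delta> r by (simp add: r_def algebra_simps)
    moreover have "\<bar>h\<bar> = \<bar>norm (x1 + z - x0) - r\<bar> * \<bar>norm (x1 + z - x0) + r\<bar>"
      by (simp add: h_def abs_mult[symmetric] power2_eq_square algebra_simps)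
    ultimately have h: "\<bar>h\<bar> \<le> norm z * (3 * r)" by (simp only:) (intro mult_mono, auto)
    have h1: "A * \<bar>h\<bar> \<le> 6 * w / \<delta> * norm z"
    proof -
      have "A * \<bar>h\<bar> \<le> A * (norm z * (3 * r))" using h A0 by (intro mult_left_mono)
      also have "\<dots> = 3 * (A * r * \<delta>) / \<delta> * norm z" using \<delta> by simp
      also have "\<dots> \<le> 3 * (2 * w) / \<delta> * norm z"
        using est(1) \<delta> by (intro mult_right_mono divide_right_mono mult_left_mono) auto
      finally show ?thesis by simp
    qed
    have h2: "B * h\<^sup>2 \<le> 54 * w / \<delta> * norm z"
    proof -
      have "h\<^sup>2 \<le> (norm z * (3 * r))\<^sup>2" using power_mono[OF h, of 2] by simp
      also have "\<dots> = 9 * r\<^sup>2 * norm z * norm z" by (simp add: power2_eq_square)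
      also have "\<dots> \<le> 9 * r\<^sup>2 * norm z * \<delta>" using z by (intro mult_left_mono) auto
      finally have "B * h\<^sup>2 \<le> B * (9 * r\<^sup>2 * norm z * \<delta>)" using B0 by (intro mult_left_mono)
      also have "\<dots> = 9 * (B * r\<^sup>2 * \<delta>\<^sup>2) / \<delta> * norm z" using \<delta> by (simp add: power2_eq_square)
      also have "\<dots> \<le> 9 * (6 * w) / \<delta> * norm z"
        using est(2) \<delta> by (intro mult_right_mono divide_right_mono mult_left_mono) auto
      finally show ?thesis by simp
    qed
    have "\<bar>P (x1 + z) - P x1\<bar> \<le> A * \<bar>h\<bar> + B * h\<^sup>2"
      unfolding Px1 using abs_triangle_ineq[of "A * h" "B * h\<^sup>2"] A0 B0
      by (simp add: P_def h_def abs_mult)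
    also have "\<dots> \<le> 6 * w / \<delta> * norm z + 54 * w / \<delta> * norm z" by (intro add_mono h1 h2)
    finally show ?thesis by (simp add: add_divide_distrib[symmetric] distrib_right[symmetric])
  qed

  \<comment> \<open>The contradiction from the subsolution inequality\<close>
  have DPx1: "norm (DP x1) = 2 * A * r" using A0 by (simp add: DP_def r_def)
  have "C1_on (closure \<Omega>) P DP" unfolding P_def DP_def by (rule C1_on_quadratic_norm)
  then have "- nonlocal \<Omega> \<nu> (ball 0 \<delta>) P x1 - nonlocal \<Omega> \<nu> (- ball 0 \<delta>) u x1
      + b0 * norm (DP x1) powr m \<le> A0"
    using visc x1\<Omega>(1) touch \<delta>(1) unfolding viscosity_subsolution_def by blast
  moreover have "\<bar>nonlocal \<Omega> \<nu> (ball 0 \<delta>) P x1\<bar> \<le> C2 * (60 * w) * \<delta> powr (- \<sigma>)"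
    using \<delta> par M2 sets w0 Pz x1\<Omega> by (intro nonlocal_ball_le) auto
  moreover have "\<bar>nonlocal \<Omega> \<nu> (- ball 0 \<delta>) u x1\<bar> \<le> C1 * w * \<delta> powr (- \<sigma>)"
    using \<delta> par M1 sets osc x1\<Omega> by (intro nonlocal_outside_ball_le) auto
  \<comment> \<open>\<open>R \<le> 1\<close> enters through \<open>\<delta> < 1\<close>, so that all
    terms are compared at the scale \<open>\<delta> powr (- \<sigma>)\<close>.\<close>
  moreover have "A0 \<le> A0 * \<delta> powr (- \<sigma>)"
  proof -
    have "1 \<le> \<delta> powr (- \<sigma>)" using powr_mono'[of "-\<sigma>" 0 \<delta>] \<delta> par by simp
    then show ?thesis using mult_left_mono[of 1 "\<delta> powr (- \<sigma>)" A0] par by simp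
  qed
  moreover have "(A0 + (60 * C2 + C1) * w + b0) * \<delta> powr (- \<sigma>) \<le> b0 * norm (DP x1) powr m"
  proof -
    \<comment> \<open>\<open>min \<alpha> (1/4) * L\<close> is the \<open>m\<close>-th root of
      \<open>K\<close>, and \<open>(\<alpha> - 1) * m = - \<sigma>\<close> turns the gradient bound
      into the required scale. The 1 in \<open>K\<close> leaves the surplus
      \<open>b0 * \<delta> powr (- \<sigma>)\<close> that makes the contradiction strict.\<close>
    define K where "K = (A0 + (60 * C2 + C1) * w) / b0 + 1"
    have K: "0 < K" unfolding K_def using par w0 by (intro add_nonneg_pos) auto
    have "min \<alpha> (1/4) * L = K powr (1 / m)"
      using \<alpha> by (simp add: L_def interior_const_def \<alpha>_def[symmetric] K_def)
    then have "K powr (1 / m) * \<delta> powr (\<alpha> - 1) \<le> norm (DP x1)" using est(3) DPx1 by simp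
    then have "(K powr (1 / m) * \<delta> powr (\<alpha> - 1)) powr m \<le> norm (DP x1) powr m"
      using par by (intro powr_mono2) auto
    also have "(K powr (1 / m) * \<delta> powr (\<alpha> - 1)) powr m = K * \<delta> powr (- \<sigma>)"
      using K par by (simp add: powr_mult powr_powr \<alpha>(3))
    finally have "b0 * (K * \<delta> powr (- \<sigma>)) \<le> b0 * norm (DP x1) powr m" using par by simp
    also have "b0 * (K * \<delta> powr (- \<sigma>)) = (A0 + (60 * C2 + C1) * w + b0) * \<delta> powr (- \<sigma>)"
      using par by (simp add: K_def field_simps)
    finally show ?thesis .
  qed
  moreover have "0 < b0 * \<delta> powr (- \<sigma>)" using par \<delta> by simp
  ultimately show False by (simp add: algebra_simps)
qed

text \<open>Up to half the radius the barrier quotient is at most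
  \<open>2 * (s / R) powr \<alpha>\<close>, and the prefactor \<open>R powr \<alpha>\<close> cancels
  the dependence on \<open>R\<close>. With the power part this gives the factor 3.\<close>

lemma interior_holder_one_sided:
  fixes \<Omega> :: "'a::euclidean_space set" and u :: "'a \<Rightarrow> real" and \<sigma> m b0 A0 C1 C2 R :: real
  defines "\<alpha> \<equiv> (m - \<sigma>) / m" and "w \<equiv> osc (closure \<Omega>) u"
  assumes par: "0 < \<sigma>" "\<sigma> < 1" "\<sigma> < m" "0 < b0" "0 \<le> A0" "0 < C1" "0 < C2"
    and data: "\<And>x. x \<in> closure \<Omega> \<Longrightarrow> sets (\<nu> x) = sets borel"
    "M1 \<Omega> \<nu> \<sigma> C1" "M2 \<Omega> \<nu> \<sigma> C2" "bounded (u ` closure \<Omega>)"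
    "viscosity_subsolution \<Omega> \<nu> b0 m A0 u"
    and R: "0 < R" "R \<le> 1" "ball x R \<subseteq> \<Omega>" and y: "norm (y - x) \<le> R / 2"
  shows "u y - u x \<le> 3 * interior_const \<sigma> m b0 A0 C1 C2 w * norm (y - x) powr \<alpha>"
proof -
  define L where "L = interior_const \<sigma> m b0 A0 C1 C2 w"
  define s where "s = norm (y - x)"
  have "x \<in> closure \<Omega>" using R closure_subset centre_in_ball by blast
  then have "0 \<le> w" using osc_ge[OF data(4), of x x] by (simp add: w_def)
  then have L: "0 < L" unfolding L_def using par by (intro interior_const_pos) auto
  have \<alpha>: "0 < \<alpha>" "\<alpha> < 1" using par by (auto simp: \<alpha>_def field_simps)
  have s: "0 \<le> s" "s \<le> R / 2" using y by (auto simp: s_def)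
  have "s\<^sup>2 \<le> (R / 2)\<^sup>2" using s by (intro power_mono)
  then have "s\<^sup>2 \<le> R\<^sup>2 / 4" by (simp add: power_divide)
  moreover have "0 < R\<^sup>2" using R by simp
  ultimately have "R\<^sup>2 / 2 \<le> R\<^sup>2 - s\<^sup>2" "0 < R\<^sup>2 - s\<^sup>2" "0 < R\<^sup>2 / 2" by linarith+
  then have "s\<^sup>2 / (R\<^sup>2 - s\<^sup>2) \<le> s\<^sup>2 / (R\<^sup>2 / 2)" 
    by (intro divide_left_mono mult_pos_pos zero_le_power2)
  also have "\<dots> = 2 * (s / R)\<^sup>2" by (simp add: power_divide)
  also have "(s / R)\<^sup>2 \<le> (s / R) powr \<alpha>"
  proof (cases "s = 0")
    case False
    then have "(s / R) powr 2 \<le> (s / R) powr \<alpha>"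
      using s R \<alpha> by (intro powr_mono') auto
    then show ?thesis using False s R by simp
  qed simp
  finally have "R powr \<alpha> * (s\<^sup>2 / (R\<^sup>2 - s\<^sup>2)) \<le> R powr \<alpha> * (2 * (s / R) powr \<alpha>)"
    by (intro mult_left_mono) auto
  also have "\<dots> = 2 * s powr \<alpha>" using s R by (simp add: powr_divide)
  finally have "L * (s powr \<alpha> + R powr \<alpha> * (s\<^sup>2 / (R\<^sup>2 - s\<^sup>2))) \<le> L * (3 * s powr \<alpha>)"
    using L by (intro mult_left_mono) auto
  moreover have "y \<in> ball x R" using y R by (simp add: dist_norm norm_minus_commute)
  ultimately show ?thesis
    using interior_barrier_bound[OF par data R, of y]
    unfolding L_def s_def w_def \<alpha>_def by simp
qed

lemma interior_holder:
  fixes \<Omega> :: "'a::euclidean_space set" and u :: "'a \<Rightarrow> real" and \<sigma> m b0 A0 C1 C2 R :: real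
  assumes par: "0 < \<sigma>" "\<sigma> < 1" "\<sigma> < m" "0 < b0" "0 \<le> A0" "0 < C1" "0 < C2"
    and data: "\<And>x. x \<in> closure \<Omega> \<Longrightarrow> sets (\<nu> x) = sets borel"
    "M1 \<Omega> \<nu> \<sigma> C1" "M2 \<Omega> \<nu> \<sigma> C2" "bounded (u ` closure \<Omega>)"
    "viscosity_subsolution \<Omega> \<nu> b0 m A0 u"
    and R: "0 < R" "R \<le> 1" "ball x R \<subseteq> \<Omega>" and y: "norm (y - x) \<le> R / 4"
  shows "\<bar>u y - u x\<bar> \<le>
    3 * interior_const \<sigma> m b0 A0 C1 C2 (osc (closure \<Omega>) u) * norm (y - x) powr ((m - \<sigma>) / m)"
proof -
  have "ball y (R / 2) \<subseteq> ball x R"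
  proof
    fix z assume "z \<in> ball y (R / 2)"
    then show "z \<in> ball x R"
      using y R norm_triangle_ineq[of "y - x" "z - y"] by (simp add: dist_norm norm_minus_commute)
  qed
  then have "ball y (R / 2) \<subseteq> \<Omega>" using R by blast
  then have "u x - u y \<le>
    3 * interior_const \<sigma> m b0 A0 C1 C2 (osc (closure \<Omega>) u) * norm (x - y) powr ((m - \<sigma>) / m)"
    using R y by (intro interior_holder_one_sided[OF par data, of "R / 2"]) (auto simp: norm_minus_commute)
  moreover have "u y - u x \<le>
    3 * interior_const \<sigma> m b0 A0 C1 C2 (osc (closure \<Omega>) u) * norm (y - x) powr ((m - \<sigma>) / m)"
    using R y by (intro interior_holder_one_sided[OF par data, of R]) auto
  ultimately show ?thesis by (simp add: abs_le_iff norm_minus_commute)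
qed

section \<open>From interior balls to the whole domain\<close>

text \<open>The points at heights \<open>T * \<theta> ^ k\<close> above \<open>x\<close> approach it
  geometrically, and each is at a quarter of the cone radius from the previous one, so
  \<open>loc\<close> applies to every step. The increments sum to a geometric series of ratio
  \<open>\<theta> powr \<alpha>\<close>, and the last gap is bridged in a small ball around
  \<open>x\<close>, whose radius does not enter the bound.\<close>

lemma holder_along_cone_axis:
  fixes \<Omega> :: "'a::euclidean_space set" and u :: "'a \<Rightarrow> real"
  assumes loc: "\<And>x y R. 0 < R \<Longrightarrow> R \<le> 1 \<Longrightarrow> ball x R \<subseteq> \<Omega> \<Longrightarrow> norm (y - x) \<le> R / 4 \<Longrightarrow>
      \<bar>u y - u x\<bar> \<le> K * norm (y - x) powr \<alpha>"
    and "0 \<le> K" "0 < \<alpha>" "norm e = 1" "0 < c" "c \<le> 1"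
    and x: "x \<in> \<Omega>" "open \<Omega>"
    and T: "0 < T" "T \<le> 1" and cone: "\<And>s. 0 < s \<Longrightarrow> s \<le> T \<Longrightarrow> ball (x + s *\<^sub>R e) (c * s) \<subseteq> \<Omega>"
  shows "\<bar>u (x + T *\<^sub>R e) - u x\<bar> \<le> K * T powr \<alpha> / (1 - (1 - c / 4) powr \<alpha>)"
proof -
  define \<theta> where "\<theta> = 1 - c / 4"
  have \<theta>: "0 < \<theta>" "\<theta> < 1" using assms by (auto simp: \<theta>_def)
  have \<theta>\<alpha>: "0 < \<theta> powr \<alpha>" "\<theta> powr \<alpha> < 1"
    using \<theta> assms powr_less_mono2[of \<alpha> \<theta> 1] by auto
  obtain R0 where R0: "0 < R0" "ball x R0 \<subseteq> \<Omega>" using x openE by blast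
  define R where "R = min 1 R0"
  have R: "0 < R" "R \<le> 1" "ball x R \<subseteq> \<Omega>" using R0 by (auto simp: R_def)
  \<comment> \<open>\<open>k\<close> counts the steps until the point is within \<open>R / 4\<close>
    of \<open>x\<close>. Varying \<open>T\<close> lets the induction restart from height
    \<open>T * \<theta>\<close>.\<close>
  have step: "\<bar>u (x + T *\<^sub>R e) - u x\<bar> \<le> K * T powr \<alpha> / (1 - \<theta> powr \<alpha>)"
    if "T * \<theta> ^ k \<le> R / 4" "0 < T" "T \<le> 1"
      "\<And>s. 0 < s \<Longrightarrow> s \<le> T \<Longrightarrow> ball (x + s *\<^sub>R e) (c * s) \<subseteq> \<Omega>" for k T
    using that
  proof (induction k arbitrary: T)
    case 0
    then have "\<bar>u (x + T *\<^sub>R e) - u x\<bar> \<le> K * norm (x + T *\<^sub>R e - x) powr \<alpha>"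
      using R assms(4) by (intro loc) auto
    also have "\<dots> = K * T powr \<alpha>" using 0 assms(4) by simp
    also have "\<dots> \<le> K * T powr \<alpha> / (1 - \<theta> powr \<alpha>)"
      using \<theta>\<alpha> assms(2) by (simp add: pos_le_divide_eq mult_left_le)
    finally show ?case .
  next
    case (Suc k)
    note T = Suc.prems(2,3)
    have T\<theta>: "T * \<theta> \<le> T" "0 < T * \<theta>" using T \<theta> mult_left_mono[of \<theta> 1 T] by auto
    have IH: "\<bar>u (x + (T * \<theta>) *\<^sub>R e) - u x\<bar> \<le> K * (T * \<theta>) powr \<alpha> / (1 - \<theta> powr \<alpha>)"
    proof (rule Suc.IH)
      show "T * \<theta> * \<theta> ^ k \<le> R / 4" using Suc.prems(1) by (simp add: mult_ac)
      show "ball (x + s *\<^sub>R e) (c * s) \<subseteq> \<Omega>" if "0 < s" "s \<le> T * \<theta>" for s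
        using that T\<theta> by (intro Suc.prems(4)) auto
    qed (use T T\<theta> in auto)
    have d: "(x + (T * \<theta>) *\<^sub>R e) - (x + T *\<^sub>R e) = - (c * T / 4) *\<^sub>R e"
      by (simp add: \<theta>_def algebra_simps)
    then have nd: "norm ((x + (T * \<theta>) *\<^sub>R e) - (x + T *\<^sub>R e)) = c * T / 4"
      unfolding d using assms(4,5) T by simp
    have "\<bar>u (x + (T * \<theta>) *\<^sub>R e) - u (x + T *\<^sub>R e)\<bar>
        \<le> K * norm ((x + (T * \<theta>) *\<^sub>R e) - (x + T *\<^sub>R e)) powr \<alpha>"
    proof (rule loc)
      show "0 < c * T" "c * T \<le> 1" using T assms(5,6) mult_mono[of c 1 T 1] by auto
      show "ball (x + T *\<^sub>R e) (c * T) \<subseteq> \<Omega>" using T by (intro Suc.prems(4)) auto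
    qed (simp only: nd order_refl)
    also have "\<dots> \<le> K * T powr \<alpha>"
      unfolding nd using T assms(2,3,5,6) mult_mono[of c 1 T T]
      by (intro mult_left_mono powr_mono2) auto
    finally have "\<bar>u (x + T *\<^sub>R e) - u x\<bar> \<le> K * T powr \<alpha> + K * (T * \<theta>) powr \<alpha> / (1 - \<theta> powr \<alpha>)"
      using IH by linarith
    \<comment> \<open>The geometric series reproduces itself:
      \<open>1 + q / (1 - q) = 1 / (1 - q)\<close> for
      \<open>q = \<theta> powr \<alpha>\<close>.\<close>
    also have "\<dots> = K * T powr \<alpha> / (1 - \<theta> powr \<alpha>)"
      using less_imp_neq[OF \<theta>\<alpha>(2)] \<theta> \<theta>\<alpha> T by (simp add: powr_mult field_simps)
    finally show ?case .
  qed
  have "(\<lambda>k. T * \<theta> ^ k) \<longlonglongrightarrow> T * 0" using \<theta> by (intro tendsto_mult_left LIMSEQ_power_zero) auto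
  then have "eventually (\<lambda>k. T * \<theta> ^ k < R / 4) sequentially" using R by (intro order_tendstoD) auto
  then obtain k where "T * \<theta> ^ k < R / 4" by (auto simp: eventually_sequentially)
  then show ?thesis using step[of T k] T cone by (simp add: \<theta>_def)
qed

section \<open>Interior cones from the C1 boundary\<close>

text \<open>On a compact ball \<open>\<gamma>\<close> is Lipschitz, and the region above a Lipschitz
  graph contains a truncated cone with axis \<open>e\<close> at each of its points. One axis serves
  all points near \<open>p\<close>, so two nearby points can later be moved in parallel.\<close>

lemma local_interior_cone:
  fixes \<Omega> :: "'a::euclidean_space set"
  assumes "C1_boundary \<Omega>" "p \<in> frontier \<Omega>"
  shows "\<exists>\<rho> e. 0 < \<rho> \<and> \<rho> \<le> 1 \<and> norm e = 1 \<and>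
    (\<forall>w\<in>\<Omega> \<inter> ball p \<rho>. \<forall>t. 0 < t \<and> t \<le> \<rho> \<longrightarrow> ball (w + t *\<^sub>R e) (\<rho> * t) \<subseteq> \<Omega>)"
proof -
  obtain r e \<gamma> g where r: "0 < r" and e: "norm e = 1" and \<gamma>: "C1_on UNIV \<gamma> g"
    and graph: "\<Omega> \<inter> ball p r = {x \<in> ball p r. \<gamma> (x - (x \<bullet> e) *\<^sub>R e) < x \<bullet> e}"
    using bspec[OF assms(1)[unfolded C1_boundary_def] assms(2)] by blast
  \<comment> \<open>The orthogonal projection onto the hyperplane in which \<open>\<gamma>\<close>
    is evaluated; it is linear and does not increase norms.\<close>
  define \<pi> where "\<pi> x = x - (x \<bullet> e) *\<^sub>R e" for x
  have ee: "e \<bullet> e = 1" using e by (simp add: dot_square_norm)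
  have \<pi>add: "\<pi> (x + y) = \<pi> x + \<pi> y" and \<pi>e: "\<pi> (t *\<^sub>R e) = 0" and \<pi>diff: "\<pi> (x - y) = \<pi> x - \<pi> y" for x y t
    using e by (auto simp: \<pi>_def inner_simps algebra_simps dot_square_norm)
  have \<pi>norm: "norm (\<pi> x) \<le> norm x" for x
  proof -
    have "\<pi> x \<bullet> \<pi> x = x \<bullet> x - (x \<bullet> e) * (x \<bullet> e)"
      unfolding \<pi>_def using ee by (simp add: inner_diff_left inner_diff_right inner_commute)
    then show ?thesis by (simp add: norm_le)
  qed
  have "bounded (g ` cball (\<pi> p) r)"
    using \<gamma> unfolding C1_on_def
    by (intro compact_imp_bounded compact_continuous_image) (auto intro: continuous_on_subset)
  then obtain K where K: "0 < K" "\<And>x. x \<in> cball (\<pi> p) r \<Longrightarrow> norm (g x) \<le> K"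
    unfolding bounded_pos by blast
  have lip: "\<bar>\<gamma> a - \<gamma> b\<bar> \<le> K * norm (a - b)" if "a \<in> cball (\<pi> p) r" "b \<in> cball (\<pi> p) r" for a b
  proof -
    have "norm (\<gamma> a - \<gamma> b) \<le> K * norm (a - b)"
    proof (rule differentiable_bound[where S = "cball (\<pi> p) r" and f' = "\<lambda>x h. g x \<bullet> h"])
      fix x assume x: "x \<in> cball (\<pi> p) r"
      show "(\<gamma> has_derivative (\<lambda>h. g x \<bullet> h)) (at x within cball (\<pi> p) r)"
        using \<gamma> unfolding C1_on_def by (auto intro: has_derivative_at_withinI)
      show "onorm (\<lambda>h. g x \<bullet> h) \<le> K"
      proof (rule onorm_bound)
        show "norm (g x \<bullet> h) \<le> K * norm h" for h
          using Cauchy_Schwarz_ineq2[of "g x" h] mult_right_mono[OF K(2)[OF x], of "norm h"] by simp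
      qed (use K in simp)
    qed (use that in auto)
    then show ?thesis by simp
  qed
  \<comment> \<open>\<open>r / 4\<close> keeps the cones, which stay within
    \<open>3 * \<rho>\<close> of \<open>p\<close>, in the ball where the graph describes
    \<open>\<Omega>\<close>. \<open>1 / (K + 1)\<close> makes the height gain, at least
    \<open>t - \<rho> * t\<close>, outweigh the rise of \<open>\<gamma>\<close>, at most
    \<open>K * \<rho> * t\<close>.\<close>
  define \<rho> where "\<rho> = min 1 (min (r / 4) (1 / (K + 1)))"
  have \<rho>: "0 < \<rho>" "\<rho> \<le> 1" "\<rho> \<le> r / 4" using r K by (auto simp: \<rho>_def)
  have "\<rho> \<le> 1 / (K + 1)" by (simp add: \<rho>_def)
  then have \<rho>K: "\<rho> * (K + 1) \<le> 1" using K by (simp add: pos_le_divide_eq)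
  have "ball (w + t *\<^sub>R e) (\<rho> * t) \<subseteq> \<Omega>" if w: "w \<in> \<Omega>" "w \<in> ball p \<rho>" and t: "0 < t" "t \<le> \<rho>" for w t
  proof
    fix z assume z: "z \<in> ball (w + t *\<^sub>R e) (\<rho> * t)"
    define v where "v = z - (w + t *\<^sub>R e)"
    have zv: "z = w + t *\<^sub>R e + v" by (simp add: v_def)
    have v: "norm v < \<rho> * t" using z by (simp add: v_def dist_norm norm_minus_commute)
    have "\<rho> * t \<le> \<rho>" using \<rho> t mult_left_mono[of t 1 \<rho>] by simp
    have wp: "norm (w - p) < \<rho>" using w by (simp add: dist_norm norm_minus_commute)
    have "norm (z - p) \<le> norm (w - p) + (norm (t *\<^sub>R e) + norm v)"
      using norm_triangle_ineq[of "w - p" "t *\<^sub>R e + v"] norm_triangle_ineq[of "t *\<^sub>R e" v]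
      by (simp add: zv algebra_simps)
    also have "norm (t *\<^sub>R e) = t" using t e by simp
    also have "norm (w - p) + (t + norm v) < 3 * \<rho>" using wp v t \<open>\<rho> * t \<le> \<rho>\<close> by linarith
    finally have zp: "norm (z - p) < r" using \<rho> r by simp
    have wr: "norm (w - p) < r" using wp \<rho> r by simp
    have wg: "\<gamma> (\<pi> w) < w \<bullet> e"
    proof -
      have "w \<in> \<Omega> \<inter> ball p r" using w wr by (simp add: dist_norm norm_minus_commute)
      then show ?thesis unfolding graph by (simp add: \<pi>_def)
    qed
    have in_cball: "\<pi> x \<in> cball (\<pi> p) r" if "norm (x - p) < r" for x
      using \<pi>norm[of "x - p"] that by (simp add: \<pi>diff dist_norm norm_minus_commute)
    have "\<pi> z - \<pi> w = \<pi> v" by (simp add: zv \<pi>add \<pi>e)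
    then have "\<gamma> (\<pi> z) \<le> \<gamma> (\<pi> w) + K * norm (\<pi> v)"
      using lip[OF in_cball[OF zp] in_cball[OF wr]] by (simp add: abs_le_iff)
    also have "\<dots> < w \<bullet> e + K * (\<rho> * t)"
      using wg v \<pi>norm[of v] K by (intro add_less_le_mono mult_left_mono) auto
    also have "\<dots> \<le> w \<bullet> e + t - \<rho> * t"
      using mult_right_mono[OF \<rho>K, of t] t by (simp add: algebra_simps)
    also have "\<dots> \<le> w \<bullet> e + t + v \<bullet> e"
      using Cauchy_Schwarz_ineq2[of v e] v e by (simp add: abs_le_iff)
    also have "\<dots> = z \<bullet> e" using e by (simp add: zv inner_simps dot_square_norm)
    finally have "\<gamma> (\<pi> z) < z \<bullet> e" .
    then have "z \<in> \<Omega> \<inter> ball p r"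
      unfolding graph using zp by (simp add: \<pi>_def dist_norm norm_minus_commute)
    then show "z \<in> \<Omega>" by simp
  qed
  then show ?thesis using \<rho> e by blast
qed

text \<open>Compactness of the frontier leaves finitely many local cones. A ball around
  \<open>x\<close> that is not contained in \<open>\<Omega>\<close> meets the frontier, hence lies
  in one of the finitely many neighbourhoods.\<close>

lemma uniform_interior_cone:
  fixes \<Omega> :: "'a::euclidean_space set"
  assumes "bounded \<Omega>" "C1_boundary \<Omega>"
  shows "\<exists>\<rho>>0. \<rho> \<le> 1 \<and> (\<forall>x\<in>\<Omega>. ball x \<rho> \<subseteq> \<Omega> \<or> (\<exists>e. norm e = 1 \<and>
    (\<forall>w\<in>\<Omega> \<inter> ball x \<rho>. \<forall>t. 0 < t \<and> t \<le> \<rho> \<longrightarrow> ball (w + t *\<^sub>R e) (\<rho> * t) \<subseteq> \<Omega>)))"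
proof -
  obtain \<rho> e where \<rho>e: "\<And>p. p \<in> frontier \<Omega> \<Longrightarrow> 0 < \<rho> p \<and> \<rho> p \<le> 1 \<and> norm (e p) = 1 \<and>
    (\<forall>w\<in>\<Omega> \<inter> ball p (\<rho> p). \<forall>t. 0 < t \<and> t \<le> \<rho> p \<longrightarrow> ball (w + t *\<^sub>R e p) (\<rho> p * t) \<subseteq> \<Omega>)"
    using local_interior_cone[OF assms(2)] by metis
  obtain F where F: "F \<subseteq> frontier \<Omega>" "finite F" "frontier \<Omega> \<subseteq> (\<Union>p\<in>F. ball p (\<rho> p / 2))"
  proof (rule compactE_image[of "frontier \<Omega>" "frontier \<Omega>" "\<lambda>p. ball p (\<rho> p / 2)"])
    show "frontier \<Omega> \<subseteq> (\<Union>p\<in>frontier \<Omega>. ball p (\<rho> p / 2))" using \<rho>e by fastforce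
  qed (use assms(1) in \<open>auto intro: compact_frontier_bounded\<close>)
  \<comment> \<open>With \<open>4 * l \<le> \<rho> p\<close>, the half radius of the cover plus
    twice \<open>l\<close> stays within \<open>\<rho> p\<close>. Inserting 1 bounds \<open>l\<close>
    and keeps the set nonempty.\<close>
  define l where "l = Min (insert 1 (\<rho> ` F)) / 4"
  have "Min (insert 1 (\<rho> ` F)) \<in> insert 1 (\<rho> ` F)" using F by (intro Min_in) auto
  then have "0 < Min (insert 1 (\<rho> ` F))" using F \<rho>e by auto
  then have l: "0 < l" by (simp add: l_def)
  have "Min (insert 1 (\<rho> ` F)) \<le> q" if "q \<in> insert 1 (\<rho> ` F)" for q
    using that F by (intro Min_le) auto
  then have lle: "4 * l \<le> 1" "\<And>p. p \<in> F \<Longrightarrow> 4 * l \<le> \<rho> p" by (auto simp: l_def)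
  have "ball x l \<subseteq> \<Omega> \<or> (\<exists>e. norm e = 1 \<and>
    (\<forall>w\<in>\<Omega> \<inter> ball x l. \<forall>t. 0 < t \<and> t \<le> l \<longrightarrow> ball (w + t *\<^sub>R e) (l * t) \<subseteq> \<Omega>))" if x: "x \<in> \<Omega>" for x
  proof (cases "ball x l \<subseteq> \<Omega>")
    case False
    then have "ball x l \<inter> frontier \<Omega> \<noteq> {}"
      using x l centre_in_ball[of x l] by (intro connected_Int_frontier connected_ball) blast+
    then obtain q where q: "dist x q < l" "q \<in> frontier \<Omega>" by auto
    then obtain p where p: "p \<in> F" "dist p q < \<rho> p / 2" using F by auto
    have near: "w \<in> ball p (\<rho> p)" if "w \<in> ball x l" for w
    proof -
      have "dist p w \<le> dist p q + (dist q x + dist x w)"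
        by (meson dist_triangle add_left_mono order_trans)
      also have "\<dots> < \<rho> p / 2 + (l + l)"
        using p q that by (intro add_strict_mono) (auto simp: dist_commute)
      finally show ?thesis using lle(2)[OF p(1)] by simp
    qed
    have "ball (w + t *\<^sub>R e p) (l * t) \<subseteq> \<Omega>" if "w \<in> \<Omega> \<inter> ball x l" "0 < t" "t \<le> l" for w t
    proof -
      have "l * t \<le> \<rho> p * t" "t \<le> \<rho> p" using lle(2)[OF p(1)] l that by (auto intro: mult_right_mono)
      then show ?thesis using \<rho>e[of p] p F(1) near that by (meson IntD1 IntD2 IntI order_trans subsetD subset_ball)
    qed
    then have "\<exists>e. norm e = 1 \<and>
      (\<forall>w\<in>\<Omega> \<inter> ball x l. \<forall>t. 0 < t \<and> t \<le> l \<longrightarrow> ball (w + t *\<^sub>R e) (l * t) \<subseteq> \<Omega>)"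
      using \<rho>e p F by blast
    then show ?thesis ..
  qed simp
  then show ?thesis using l lle by (intro exI[of _ l]) auto
qed

section \<open>The global estimate\<close>

text \<open>Two close points near the boundary are pushed inward by the same vector: their distance
  is unchanged, while the ball available around them becomes large enough for the interior estimate.
  \<open>G\<close> precedes \<open>u\<close>, \<open>K\<close> and \<open>w\<close>, so it depends
  on \<open>\<Omega>\<close> and \<open>\<alpha>\<close> only.\<close>

lemma holder_from_interior:
  fixes \<Omega> :: "'a::euclidean_space set" and \<alpha> :: real
  assumes "bounded \<Omega>" "open \<Omega>" "C1_boundary \<Omega>" "0 < \<alpha>"
  shows "\<exists>G>0. \<forall>(u :: 'a \<Rightarrow> real) K w. 0 \<le> K \<and> (\<forall>x\<in>\<Omega>. \<forall>y\<in>\<Omega>. \<bar>u x - u y\<bar> \<le> w) \<and>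
    (\<forall>x y R. 0 < R \<and> R \<le> 1 \<and> ball x R \<subseteq> \<Omega> \<and> norm (y - x) \<le> R / 4 \<longrightarrow>
      \<bar>u y - u x\<bar> \<le> K * norm (y - x) powr \<alpha>) \<longrightarrow>
    (\<forall>x\<in>\<Omega>. \<forall>y\<in>\<Omega>. \<bar>u x - u y\<bar> \<le> G * (K + w) * norm (x - y) powr \<alpha>)"
proof -
  obtain \<rho> where \<rho>: "0 < \<rho>" "\<rho> \<le> 1"
    and cone: "\<And>x. x \<in> \<Omega> \<Longrightarrow> \<not> ball x \<rho> \<subseteq> \<Omega> \<Longrightarrow> \<exists>e. norm e = 1 \<and>
      (\<forall>w\<in>\<Omega> \<inter> ball x \<rho>. \<forall>t. 0 < t \<and> t \<le> \<rho> \<longrightarrow> ball (w + t *\<^sub>R e) (\<rho> * t) \<subseteq> \<Omega>)"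
    using uniform_interior_cone[OF assms(1,3)] by blast
  \<comment> \<open>For \<open>d < \<eta>\<close> the height \<open>4 * d / \<rho>\<close> chosen
    below stays under \<open>\<rho>\<close>; moreover \<open>\<eta> \<le> \<rho> / 4\<close> is the
    distance \<open>loc\<close> admits for radius \<open>\<rho>\<close>.\<close>
  define \<eta> where "\<eta> = \<rho>\<^sup>2 / 4"
  define q where "q = 1 - (1 - \<rho> / 4) powr \<alpha>"
  \<comment> \<open>Two moves along cone axes and one step between the translates; \<open>G2\<close>
    serves points at distance at least \<open>\<eta>\<close>, where the bound \<open>w\<close>
    suffices.\<close>
  define G1 where "G1 = 2 * (4 / \<rho>) powr \<alpha> / q + 1"
  define G2 where "G2 = (1 / \<eta>) powr \<alpha>"
  have \<eta>: "0 < \<eta>" "\<eta> \<le> \<rho> / 4"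
    using \<rho> mult_left_mono[of \<rho> 1 \<rho>] by (auto simp: \<eta>_def power2_eq_square)
  have q: "0 < q" using \<rho> assms(4) powr_less_mono2[of \<alpha> "1 - \<rho> / 4" 1] by (simp add: q_def)
  have G1: "1 \<le> G1" using q by (simp add: G1_def)
  have G2: "0 \<le> G2" by (simp add: G2_def)
  have main: "\<bar>u x - u y\<bar> \<le> (G1 + G2) * (K + w) * norm (x - y) powr \<alpha>"
    if K: "0 \<le> K" and w: "\<And>x y. x \<in> \<Omega> \<Longrightarrow> y \<in> \<Omega> \<Longrightarrow> \<bar>u x - u y\<bar> \<le> w"
      and loc: "\<And>x y R. 0 < R \<Longrightarrow> R \<le> 1 \<Longrightarrow> ball x R \<subseteq> \<Omega> \<Longrightarrow> norm (y - x) \<le> R / 4 \<Longrightarrow>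
        \<bar>u y - u x\<bar> \<le> K * norm (y - x) powr \<alpha>"
      and xy: "x \<in> \<Omega>" "y \<in> \<Omega>" for u :: "'a \<Rightarrow> real" and K w x y
  proof -
    define d where "d = norm (x - y)"
    have d: "0 \<le> d" and d': "norm (y - x) = d" by (auto simp: d_def norm_minus_commute)
    have w0: "0 \<le> w" using w[OF xy] by simp
    have "\<bar>u x - u y\<bar> \<le> G1 * K * d powr \<alpha> \<or> \<bar>u x - u y\<bar> \<le> G2 * w * d powr \<alpha>"
    proof (cases "d < \<eta>")
      case False
      have "1 \<le> (1 / \<eta> * d) powr \<alpha>"
        using False \<eta> assms(4) by (intro ge_one_powr_ge_zero) (auto simp: field_simps)
      also have "\<dots> = G2 * d powr \<alpha>" using \<eta> d unfolding G2_def by (intro powr_mult)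
      finally have "w * 1 \<le> w * (G2 * d powr \<alpha>)" using w0 by (intro mult_left_mono)
      then show ?thesis using w[OF xy] by (simp add: mult_ac)
    next
      case True
      have near: "\<bar>u x - u y\<bar> \<le> G1 * K * d powr \<alpha>" if "\<bar>u x - u y\<bar> \<le> K * d powr \<alpha>"
        using that mult_right_mono[OF G1, of "K * d powr \<alpha>"] K by (simp add: mult_ac)
      show ?thesis
      \<comment> \<open>The case \<open>d = 0\<close> is split off here so that the height
        \<open>T\<close> below is positive.\<close>
      proof (cases "ball x \<rho> \<subseteq> \<Omega> \<or> d = 0")
        case True
        then show ?thesis
        proof
          assume "ball x \<rho> \<subseteq> \<Omega>"
          then show ?thesis using loc[of \<rho> x y] \<rho> \<open>d < \<eta>\<close> \<eta> d' near by (simp add: abs_minus_commute)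
        qed (simp add: d_def)
      next
        case False
        then have "0 < d" using d by simp
        obtain e where e: "norm e = 1"
          and c: "\<And>v t. v \<in> \<Omega> \<Longrightarrow> v \<in> ball x \<rho> \<Longrightarrow> 0 < t \<Longrightarrow> t \<le> \<rho> \<Longrightarrow> ball (v + t *\<^sub>R e) (\<rho> * t) \<subseteq> \<Omega>"
          using cone[OF xy(1)] False by blast
        \<comment> \<open>At this height the cone contains a ball of radius
          \<open>\<rho> * T = 4 * d\<close> around the translate of \<open>x\<close>, exactly what
          \<open>loc\<close> requires for distance \<open>d\<close>.\<close>
        define T where "T = 4 * d / \<rho>"
        have T: "0 < T" "T \<le> \<rho>" "\<rho> * T = 4 * d" "T = 4 / \<rho> * d"
          using \<rho> \<open>0 < d\<close> \<open>d < \<eta>\<close> by (auto simp: T_def \<eta>_def field_simps power2_eq_square)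
        have "T \<le> 1" using T(2) \<rho> by linarith
        have ax: "\<bar>u (v + T *\<^sub>R e) - u v\<bar> \<le> K * T powr \<alpha> / q" if "v \<in> \<Omega>" "v \<in> ball x \<rho>" for v
          unfolding q_def using loc K assms(2,4) e \<rho> that T(1,2) \<open>T \<le> 1\<close> c
          by (intro holder_along_cone_axis[where \<Omega> = \<Omega>]) auto
        have "x \<in> ball x \<rho>" "y \<in> ball x \<rho>"
          using \<rho> \<open>d < \<eta>\<close> \<eta> by (auto simp: dist_norm d_def)
        then have "\<bar>u (x + T *\<^sub>R e) - u x\<bar> \<le> K * T powr \<alpha> / q" "\<bar>u (y + T *\<^sub>R e) - u y\<bar> \<le> K * T powr \<alpha> / q"
          using ax xy by auto
        moreover have "\<bar>u (y + T *\<^sub>R e) - u (x + T *\<^sub>R e)\<bar> \<le> K * norm ((y + T *\<^sub>R e) - (x + T *\<^sub>R e)) powr \<alpha>"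
        proof (rule loc)
          show "ball (x + T *\<^sub>R e) (4 * d) \<subseteq> \<Omega>"
            using c[OF xy(1) \<open>x \<in> ball x \<rho>\<close> T(1,2)] T(3) by simp
        qed (use \<open>0 < d\<close> \<open>d < \<eta>\<close> \<eta> \<rho> d' in auto)
        ultimately have "\<bar>u x - u y\<bar> \<le> 2 * (K * T powr \<alpha> / q) + K * d powr \<alpha>"
          by (simp add: d')
        also have "\<dots> = G1 * K * d powr \<alpha>"
          unfolding T(4) G1_def using d \<rho> powr_mult[of "4 / \<rho>" d \<alpha>] by (simp add: algebra_simps)
        finally show ?thesis ..
      qed
    qed
    moreover have "G1 * K * d powr \<alpha> \<le> (G1 + G2) * (K + w) * d powr \<alpha>"
      "G2 * w * d powr \<alpha> \<le> (G1 + G2) * (K + w) * d powr \<alpha>"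
      using G1 G2 K w0 by (auto intro!: mult_right_mono mult_mono)
    ultimately show ?thesis by (auto simp: d_def)
  qed
  show ?thesis
  proof (intro exI[of _ "G1 + G2"] conjI allI impI ballI; (elim conjE)?)
    show "0 < G1 + G2" using G1 G2 by linarith
  qed (rule main; blast)
qed

section \<open>Continuous extension and assembly\<close>

lemma holder_imp_uniformly_continuous_on:
  fixes u :: "'a::real_normed_vector \<Rightarrow> real"
  assumes "0 < \<alpha>" "0 < C" and "\<And>x y. x \<in> S \<Longrightarrow> y \<in> S \<Longrightarrow> \<bar>u x - u y\<bar> \<le> C * norm (x - y) powr \<alpha>"
  shows "uniformly_continuous_on S u"
  unfolding uniformly_continuous_on_def
proof (intro allI impI)
  fix \<epsilon> :: real assume \<epsilon>: "0 < \<epsilon>"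
  define d where "d = (\<epsilon> / C) powr (1 / \<alpha>)"
  have d: "0 < d" "C * d powr \<alpha> = \<epsilon>" using \<epsilon> assms by (auto simp: d_def powr_powr)
  show "\<exists>d>0. \<forall>x\<in>S. \<forall>x'\<in>S. dist x' x < d \<longrightarrow> dist (u x') (u x) < \<epsilon>"
  proof (intro exI conjI ballI impI)
    fix x x' assume x: "x \<in> S" "x' \<in> S" and "dist x' x < d"
    then have "C * norm (x' - x) powr \<alpha> < C * d powr \<alpha>"
      using assms by (intro mult_strict_left_mono powr_less_mono2) (auto simp: dist_norm)
    then show "dist (u x') (u x) < \<epsilon>" using assms(3)[OF x(2,1)] d by (simp add: dist_real_def)
  qed (rule d)
qed

theorem proposition3p3:
  fixes \<Omega> :: "'a::euclidean_space set" and \<sigma> m b0 A0 C1 C2 :: real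
  assumes "bounded \<Omega>" and "C1_domain \<Omega>"
    and "0 < \<sigma>" and "\<sigma> < 1" and "\<sigma> < m" and "0 < b0" and "0 \<le> A0"
    and "0 < C1" and "0 < C2"
  shows "\<exists>C0 :: real \<Rightarrow> real. (\<forall>R. 0 < C0 R) \<and>
    (\<forall>(\<nu> :: 'a \<Rightarrow> 'a measure) (u :: 'a \<Rightarrow> real).
       (\<forall>x\<in>closure \<Omega>. regular_measure (\<nu> x)) \<and>
       M0_1 \<Omega> \<nu> \<and> M0_2 \<Omega> \<nu> \<and> M1 \<Omega> \<nu> \<sigma> C1 \<and> M2 \<Omega> \<nu> \<sigma> C2 \<and>
       bounded (u ` closure \<Omega>) \<and> viscosity_subsolution \<Omega> \<nu> b0 m A0 u \<longrightarrow>
         (\<forall>x\<in>\<Omega>. \<forall>y\<in>\<Omega>.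
            \<bar>u x - u y\<bar> \<le> C0 (osc (closure \<Omega>) u) * norm (x - y) powr ((m - \<sigma>) / m)) \<and>
         (\<exists>v. continuous_on (closure \<Omega>) v \<and> (\<forall>x\<in>\<Omega>. v x = u x)))"
proof -
  note par = assms(3-9)
  define \<alpha> where "\<alpha> = (m - \<sigma>) / m"
  have \<alpha>: "0 < \<alpha>" using par by (simp add: \<alpha>_def)
  have dom: "open \<Omega>" "\<Omega> \<noteq> {}" "C1_boundary \<Omega>" using assms(2) by (auto simp: C1_domain_def)
  obtain G where G: "0 < G" and glob: "\<And>(u :: 'a \<Rightarrow> real) K w. 0 \<le> K \<Longrightarrow>
      (\<And>x y. x \<in> \<Omega> \<Longrightarrow> y \<in> \<Omega> \<Longrightarrow> \<bar>u x - u y\<bar> \<le> w) \<Longrightarrow>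
      (\<And>x y R. 0 < R \<Longrightarrow> R \<le> 1 \<Longrightarrow> ball x R \<subseteq> \<Omega> \<Longrightarrow> norm (y - x) \<le> R / 4 \<Longrightarrow>
        \<bar>u y - u x\<bar> \<le> K * norm (y - x) powr \<alpha>) \<Longrightarrow>
      (\<forall>x\<in>\<Omega>. \<forall>y\<in>\<Omega>. \<bar>u x - u y\<bar> \<le> G * (K + w) * norm (x - y) powr \<alpha>)"
    using holder_from_interior[OF assms(1) dom(1,3) \<alpha>] by metis
  define K where "K w = 3 * interior_const \<sigma> m b0 A0 C1 C2 w" for w
  have K: "0 < K w" if "0 \<le> w" for w
    using interior_const_pos[of \<sigma> m b0 A0 C1 C2 w] par that by (simp add: K_def)
  \<comment> \<open>Absolute values make \<open>C0\<close> positive on all reals, also at negative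
    arguments, which are never oscillations. Only the data enter, as \<open>G\<close> was fixed
    before \<open>\<nu>\<close> and \<open>u\<close>.\<close>
  define C0 where "C0 w = G * (K \<bar>w\<bar> + \<bar>w\<bar>)" for w
  have C0: "0 < C0 w" for w
    unfolding C0_def using G K[of "\<bar>w\<bar>"] by (intro mult_pos_pos add_pos_nonneg) auto
  show ?thesis
  proof (intro exI[of _ C0] conjI allI impI; (elim conjE)?)
    fix \<nu> :: "'a \<Rightarrow> 'a measure" and u :: "'a \<Rightarrow> real"
    assume reg: "\<forall>x\<in>closure \<Omega>. regular_measure (\<nu> x)" and M: "M1 \<Omega> \<nu> \<sigma> C1" "M2 \<Omega> \<nu> \<sigma> C2"
      and u: "bounded (u ` closure \<Omega>)" "viscosity_subsolution \<Omega> \<nu> b0 m A0 u"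
    define w where "w = osc (closure \<Omega>) u"
    have osc: "\<bar>u x - u y\<bar> \<le> w" if "x \<in> \<Omega>" "y \<in> \<Omega>" for x y
      using osc_ge[OF u(1)] that closure_subset[of \<Omega>] by (auto simp: w_def)
    then have w0: "0 \<le> w" using dom(2) by (metis abs_ge_zero equals0I order_trans)
    have sets: "sets (\<nu> x) = sets borel" if "x \<in> closure \<Omega>" for x
      using reg that by (simp add: regular_measure_def)
    have loc: "\<bar>u y - u x\<bar> \<le> K w * norm (y - x) powr \<alpha>"
      if "0 < R" "R \<le> 1" "ball x R \<subseteq> \<Omega>" "norm (y - x) \<le> R / 4" for x y R
      using interior_holder[OF par sets M u that] by (simp add: K_def w_def \<alpha>_def)
    have "\<forall>x\<in>\<Omega>. \<forall>y\<in>\<Omega>. \<bar>u x - u y\<bar> \<le> G * (K w + w) * norm (x - y) powr \<alpha>"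
      using glob[OF less_imp_le[OF K[OF w0]] osc loc] .
    then have H: "\<forall>x\<in>\<Omega>. \<forall>y\<in>\<Omega>. \<bar>u x - u y\<bar> \<le> C0 w * norm (x - y) powr \<alpha>"
      using w0 by (simp add: C0_def)
    then show "\<forall>x\<in>\<Omega>. \<forall>y\<in>\<Omega>.
        \<bar>u x - u y\<bar> \<le> C0 (osc (closure \<Omega>) u) * norm (x - y) powr ((m - \<sigma>) / m)"
      by (simp add: w_def \<alpha>_def)
    from H have "uniformly_continuous_on \<Omega> u"
      using \<alpha> C0 by (intro holder_imp_uniformly_continuous_on[of \<alpha> "C0 w"]) auto
    then obtain v where "uniformly_continuous_on (closure \<Omega>) v" "\<And>x. x \<in> \<Omega> \<Longrightarrow> u x = v x"
      by (rule uniformly_continuous_on_extension_on_closure) auto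
    then show "\<exists>v. continuous_on (closure \<Omega>) v \<and> (\<forall>x\<in>\<Omega>. v x = u x)"
      by (metis uniformly_continuous_imp_continuous)
  qed (rule C0)
qed

end
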